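(* Every nearly Sasakian manifold is a contact manifold: if $(M,\phi,\xi,\eta,g)$ is a nearly Sasakian manifold of dimension $2n+1$, then $\eta$ is a contact form, i.e. $\eta\wedge(d\eta)^n\neq0$ at every point of $M$.
   Context: All manifolds are smooth and connected; $\nabla$ is the Levi-Civita connection of $g$. An almost contact metric structure $(\phi,\xi,\eta,g)$ on $M^{2n+1}$ consists of a $(1,1)$-tensor field $\phi$, a vector field $\xi$, a $1$-form $\eta$ and a Riemannian metric $g$ with $\phi^2=-I+\eta\otimes\xi$, $\eta(\xi)=1$, $g(\phi X,\phi Y)=g(X,Y)-\eta(X)\eta(Y)$. It is nearly Sasakian if $(\nabla_X\phi)Y+(\nabla_Y\phi)X=2g(X,Y)\xi-\eta(X)Y-\eta(Y)X$ for all vector fields $X,Y$. *)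

theory Defs
  imports "HOL-Analysis.Analysis" "HOL-Combinatorics.Permutations"
begin

section \<open>Smooth manifolds\<close>

text \<open>\<open>k\<close> times continuously differentiable maps on an open set \<open>S\<close> of a finite-dimensional space:
  all iterated directional derivatives up to order \<open>k\<close> exist and are continuous.\<close>

primrec k_smooth_on :: "nat \<Rightarrow> 'v::euclidean_space set \<Rightarrow> ('v \<Rightarrow> 'w::real_normed_vector) \<Rightarrow> bool"
where
  "k_smooth_on 0 S f \<longleftrightarrow> continuous_on S f"
| "k_smooth_on (Suc k) S f \<longleftrightarrow>
     f differentiable_on S \<and> (\<forall>v. k_smooth_on k S (\<lambda>x. frechet_derivative f (at x) v))"

definition smooth_on :: "'v::euclidean_space set \<Rightarrow> ('v \<Rightarrow> 'w::real_normed_vector) \<Rightarrow> bool" where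
  "smooth_on S f \<longleftrightarrow> (\<forall>k. k_smooth_on k S f)"

text \<open>The points of a manifold are the elements of a type of class \<open>t2_space\<close> and
  \<open>second_countable_topology\<close>; the smooth structure is given by an atlas, which need not be
  maximal. A chart is a pair of its domain and its coordinate map; the type \<open>'m\<close> indexes the
  coordinates, so the dimension is \<open>CARD('m)\<close>.\<close>

type_synonym ('a, 'm) chart = "'a set \<times> ('a \<Rightarrow> real ^ 'm)"

definition topological_chart :: "('a::topological_space, 'm::finite) chart \<Rightarrow> bool" where
  "topological_chart = (\<lambda>(U, x). open U \<and> open (x ` U) \<and> homeomorphism U (x ` U) x (inv_into U x))"

definition smooth_atlas :: "('a::topological_space, 'm::finite) chart set \<Rightarrow> bool" where
  "smooth_atlas \<A> \<longleftrightarrow>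
     (\<forall>c\<in>\<A>. topological_chart c) \<and>
     (\<Union>(U, x)\<in>\<A>. U) = UNIV \<and>
     (\<forall>(U, x)\<in>\<A>. \<forall>(V, y)\<in>\<A>. smooth_on (x ` (U \<inter> V)) (y \<circ> inv_into U x))"

definition connected_smooth_manifold ::
  "('a::{t2_space,second_countable_topology}, 'm::finite) chart set \<Rightarrow> bool" where
  "connected_smooth_manifold \<A> \<longleftrightarrow> smooth_atlas \<A> \<and> connected (UNIV :: 'a set)"

definition smooth_fun :: "('a::topological_space, 'm::finite) chart set \<Rightarrow> ('a \<Rightarrow> real) \<Rightarrow> bool" where
  "smooth_fun \<A> f \<longleftrightarrow> (\<forall>(U, x)\<in>\<A>. smooth_on (x ` U) (f \<circ> inv_into U x))"

definition smooth_curve ::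
  "('a::topological_space, 'm::finite) chart set \<Rightarrow> real \<Rightarrow> (real \<Rightarrow> 'a) \<Rightarrow> bool" where
  "smooth_curve \<A> \<epsilon> \<gamma> \<longleftrightarrow>
     continuous_on {-\<epsilon><..<\<epsilon>} \<gamma> \<and>
     (\<forall>(U, x)\<in>\<A>. smooth_on ({-\<epsilon><..<\<epsilon>} \<inter> \<gamma> -` U) (x \<circ> \<gamma>))"


section \<open>Tangent vectors and vector fields\<close>

text \<open>A tangent vector at \<open>p\<close> is the velocity at time \<open>0\<close> of a smooth curve through \<open>p\<close>, regarded
  as the directional derivative operator \<open>f \<mapsto> (f \<circ> \<gamma>)'(0)\<close> on smooth functions. Operators have
  the value \<open>0\<close> on functions that are not smooth, so that two tangent vectors (or vector fields)
  are equal as soon as they agree on smooth functions.\<close>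

type_synonym 'a tvec = "('a \<Rightarrow> real) \<Rightarrow> real"

type_synonym 'a vfield = "'a \<Rightarrow> 'a tvec"

definition velocity ::
  "('a::topological_space, 'm::finite) chart set \<Rightarrow> (real \<Rightarrow> 'a) \<Rightarrow> 'a tvec" where
  "velocity \<A> \<gamma> = (\<lambda>f. if smooth_fun \<A> f then deriv (f \<circ> \<gamma>) 0 else 0)"

definition tangent_space :: "('a::topological_space, 'm::finite) chart set \<Rightarrow> 'a \<Rightarrow> 'a tvec set" where
  "tangent_space \<A> p = {velocity \<A> \<gamma> | \<gamma> \<epsilon>. \<epsilon> > 0 \<and> smooth_curve \<A> \<epsilon> \<gamma> \<and> \<gamma> 0 = p}"

definition vector_fields :: "('a::topological_space, 'm::finite) chart set \<Rightarrow> 'a vfield set" where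
  "vector_fields \<A> =
     {X. (\<forall>p. X p \<in> tangent_space \<A> p) \<and>
         (\<forall>f. smooth_fun \<A> f \<longrightarrow> smooth_fun \<A> (\<lambda>p. X p f))}"

definition lie_bracket :: "'a vfield \<Rightarrow> 'a vfield \<Rightarrow> 'a vfield" where
  "lie_bracket X Y = (\<lambda>p f. X p (\<lambda>q. Y q f) - Y p (\<lambda>q. X q f))"


section \<open>Tensor fields\<close>

text \<open>Tensor fields are given pointwise, as multilinear maps on the tangent spaces; they are
  smooth if they send smooth vector fields to smooth objects. Only their values on tangent vectors
  matter.\<close>

definition one_form ::
  "('a::topological_space, 'm::finite) chart set \<Rightarrow> ('a \<Rightarrow> 'a tvec \<Rightarrow> real) \<Rightarrow> bool" where
  "one_form \<A> \<eta> \<longleftrightarrow>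
     (\<forall>p. \<forall>u\<in>tangent_space \<A> p. \<forall>v\<in>tangent_space \<A> p. \<forall>a b.
        \<eta> p (\<lambda>f. a * u f + b * v f) = a * \<eta> p u + b * \<eta> p v) \<and>
     (\<forall>X\<in>vector_fields \<A>. smooth_fun \<A> (\<lambda>p. \<eta> p (X p)))"

definition endomorphism_field ::
  "('a::topological_space, 'm::finite) chart set \<Rightarrow> ('a \<Rightarrow> 'a tvec \<Rightarrow> 'a tvec) \<Rightarrow> bool" where
  "endomorphism_field \<A> \<phi> \<longleftrightarrow>
     (\<forall>p. \<forall>u\<in>tangent_space \<A> p. \<phi> p u \<in> tangent_space \<A> p) \<and>
     (\<forall>p. \<forall>u\<in>tangent_space \<A> p. \<forall>v\<in>tangent_space \<A> p. \<forall>a b.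
        \<phi> p (\<lambda>f. a * u f + b * v f) = (\<lambda>f. a * \<phi> p u f + b * \<phi> p v f)) \<and>
     (\<forall>X\<in>vector_fields \<A>. (\<lambda>p. \<phi> p (X p)) \<in> vector_fields \<A>)"

definition riemannian_metric ::
  "('a::topological_space, 'm::finite) chart set \<Rightarrow> ('a \<Rightarrow> 'a tvec \<Rightarrow> 'a tvec \<Rightarrow> real) \<Rightarrow> bool" where
  "riemannian_metric \<A> g \<longleftrightarrow>
     (\<forall>p. \<forall>u\<in>tangent_space \<A> p. \<forall>v\<in>tangent_space \<A> p. \<forall>w\<in>tangent_space \<A> p. \<forall>a b.
        g p (\<lambda>f. a * u f + b * v f) w = a * g p u w + b * g p v w) \<and>
     (\<forall>p. \<forall>u\<in>tangent_space \<A> p. \<forall>v\<in>tangent_space \<A> p. g p u v = g p v u) \<and>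
     (\<forall>p. \<forall>u\<in>tangent_space \<A> p. u \<noteq> (\<lambda>f. 0) \<longrightarrow> g p u u > 0) \<and>
     (\<forall>X\<in>vector_fields \<A>. \<forall>Y\<in>vector_fields \<A>. smooth_fun \<A> (\<lambda>p. g p (X p) (Y p)))"


section \<open>The Levi-Civita connection\<close>

definition affine_connection ::
  "('a::topological_space, 'm::finite) chart set \<Rightarrow> ('a vfield \<Rightarrow> 'a vfield \<Rightarrow> 'a vfield) \<Rightarrow> bool" where
  "affine_connection \<A> D \<longleftrightarrow>
     (\<forall>X\<in>vector_fields \<A>. \<forall>Y\<in>vector_fields \<A>. D X Y \<in> vector_fields \<A>) \<and>
     (\<forall>X\<in>vector_fields \<A>. \<forall>Y\<in>vector_fields \<A>. \<forall>Z\<in>vector_fields \<A>.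
        \<forall>h k. smooth_fun \<A> h \<longrightarrow> smooth_fun \<A> k \<longrightarrow>
          D (\<lambda>p f. h p * X p f + k p * Y p f) Z = (\<lambda>p f. h p * D X Z p f + k p * D Y Z p f)) \<and>
     (\<forall>X\<in>vector_fields \<A>. \<forall>Y\<in>vector_fields \<A>. \<forall>Z\<in>vector_fields \<A>. \<forall>a b.
          D X (\<lambda>p f. a * Y p f + b * Z p f) = (\<lambda>p f. a * D X Y p f + b * D X Z p f)) \<and>
     (\<forall>X\<in>vector_fields \<A>. \<forall>Y\<in>vector_fields \<A>. \<forall>h. smooth_fun \<A> h \<longrightarrow>
          D X (\<lambda>p f. h p * Y p f) = (\<lambda>p f. X p h * Y p f + h p * D X Y p f))"

definition levi_civita_connection ::
  "('a::topological_space, 'm::finite) chart set \<Rightarrow> ('a \<Rightarrow> 'a tvec \<Rightarrow> 'a tvec \<Rightarrow> real) \<Rightarrow>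
   ('a vfield \<Rightarrow> 'a vfield \<Rightarrow> 'a vfield) \<Rightarrow> bool" where
  "levi_civita_connection \<A> g D \<longleftrightarrow>
     affine_connection \<A> D \<and>
     (\<forall>X\<in>vector_fields \<A>. \<forall>Y\<in>vector_fields \<A>.
        (\<lambda>p f. D X Y p f - D Y X p f) = lie_bracket X Y) \<and>
     (\<forall>X\<in>vector_fields \<A>. \<forall>Y\<in>vector_fields \<A>. \<forall>Z\<in>vector_fields \<A>. \<forall>p.
        X p (\<lambda>q. g q (Y q) (Z q)) = g p (D X Y p) (Z p) + g p (Y p) (D X Z p))"

text \<open>\<open>(\<nabla>\<^sub>X \<phi>) Y = \<nabla>\<^sub>X (\<phi> Y) - \<phi> (\<nabla>\<^sub>X Y)\<close>, where \<open>\<nabla>\<close> is written \<open>D\<close>\<close>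

definition cov_deriv_endo ::
  "('a vfield \<Rightarrow> 'a vfield \<Rightarrow> 'a vfield) \<Rightarrow> ('a \<Rightarrow> 'a tvec \<Rightarrow> 'a tvec) \<Rightarrow>
   'a vfield \<Rightarrow> 'a vfield \<Rightarrow> 'a vfield" where
  "cov_deriv_endo D \<phi> X Y = (\<lambda>p f. D X (\<lambda>q. \<phi> q (Y q)) p f - \<phi> p (D X Y p) f)"


section \<open>Nearly Sasakian structures\<close>

definition almost_contact_metric ::
  "('a::topological_space, 'm::finite) chart set \<Rightarrow> ('a \<Rightarrow> 'a tvec \<Rightarrow> 'a tvec) \<Rightarrow> 'a vfield \<Rightarrow>
   ('a \<Rightarrow> 'a tvec \<Rightarrow> real) \<Rightarrow> ('a \<Rightarrow> 'a tvec \<Rightarrow> 'a tvec \<Rightarrow> real) \<Rightarrow> bool" where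
  "almost_contact_metric \<A> \<phi> \<xi> \<eta> g \<longleftrightarrow>
     endomorphism_field \<A> \<phi> \<and> \<xi> \<in> vector_fields \<A> \<and> one_form \<A> \<eta> \<and> riemannian_metric \<A> g \<and>
     (\<forall>p. \<forall>u\<in>tangent_space \<A> p. \<phi> p (\<phi> p u) = (\<lambda>f. - u f + \<eta> p u * \<xi> p f)) \<and>
     (\<forall>p. \<eta> p (\<xi> p) = 1) \<and>
     (\<forall>p. \<forall>u\<in>tangent_space \<A> p. \<forall>v\<in>tangent_space \<A> p.
        g p (\<phi> p u) (\<phi> p v) = g p u v - \<eta> p u * \<eta> p v)"

definition nearly_sasakian ::
  "('a::topological_space, 'm::finite) chart set \<Rightarrow> ('a vfield \<Rightarrow> 'a vfield \<Rightarrow> 'a vfield) \<Rightarrow>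
   ('a \<Rightarrow> 'a tvec \<Rightarrow> 'a tvec) \<Rightarrow> 'a vfield \<Rightarrow>
   ('a \<Rightarrow> 'a tvec \<Rightarrow> real) \<Rightarrow> ('a \<Rightarrow> 'a tvec \<Rightarrow> 'a tvec \<Rightarrow> real) \<Rightarrow> bool" where
  "nearly_sasakian \<A> D \<phi> \<xi> \<eta> g \<longleftrightarrow>
     almost_contact_metric \<A> \<phi> \<xi> \<eta> g \<and>
     (\<forall>X\<in>vector_fields \<A>. \<forall>Y\<in>vector_fields \<A>. \<forall>p f.
        cov_deriv_endo D \<phi> X Y p f + cov_deriv_endo D \<phi> Y X p f =
          2 * g p (X p) (Y p) * \<xi> p f - \<eta> p (X p) * Y p f - \<eta> p (Y p) * X p f)"


section \<open>Differential forms and contact forms\<close>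

text \<open>A differential \<open>k\<close>-form is represented by its action on vector fields: it maps fields
  \<open>X 0, \<dots>, X (k - 1)\<close> to a function on the manifold, and ignores \<open>X i\<close> for \<open>i \<ge> k\<close>.\<close>

type_synonym 'a dform = "(nat \<Rightarrow> 'a vfield) \<Rightarrow> 'a \<Rightarrow> real"

definition form_of_one_form :: "('a \<Rightarrow> 'a tvec \<Rightarrow> real) \<Rightarrow> 'a dform" where
  "form_of_one_form \<eta> = (\<lambda>X p. \<eta> p (X 0 p))"

text \<open>\<open>d\<eta>(X, Y) = X (\<eta>(Y)) - Y (\<eta>(X)) - \<eta>([X, Y])\<close>; some authors include a factor \<open>1/2\<close>, which
  does not affect the notion of a contact form.\<close>

definition ext_deriv :: "('a \<Rightarrow> 'a tvec \<Rightarrow> real) \<Rightarrow> 'a dform" where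
  "ext_deriv \<eta> = (\<lambda>X p. X 0 p (\<lambda>q. \<eta> q (X 1 q)) - X 1 p (\<lambda>q. \<eta> q (X 0 q))
                        - \<eta> p (lie_bracket (X 0) (X 1) p))"

definition wedge :: "nat \<Rightarrow> nat \<Rightarrow> 'a dform \<Rightarrow> 'a dform \<Rightarrow> 'a dform" where
  "wedge k l \<alpha> \<beta> = (\<lambda>X p.
     (\<Sum>\<sigma> | \<sigma> permutes {..<k + l}.
        of_int (sign \<sigma>) * \<alpha> (\<lambda>i. X (\<sigma> i)) p * \<beta> (\<lambda>i. X (\<sigma> (k + i))) p) / (fact k * fact l))"

text \<open>The \<open>n\<close>-th wedge power of a 2-form, which is a \<open>2n\<close>-form.\<close>

primrec wedge_power2 :: "'a dform \<Rightarrow> nat \<Rightarrow> 'a dform" where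
  "wedge_power2 \<omega> 0 = (\<lambda>X p. 1)"
| "wedge_power2 \<omega> (Suc n) = wedge 2 (2 * n) \<omega> (wedge_power2 \<omega> n)"

definition form_nonzero_at ::
  "('a::topological_space, 'm::finite) chart set \<Rightarrow> nat \<Rightarrow> 'a dform \<Rightarrow> 'a \<Rightarrow> bool" where
  "form_nonzero_at \<A> k \<omega> p \<longleftrightarrow> (\<exists>X. (\<forall>i<k. X i \<in> vector_fields \<A>) \<and> \<omega> X p \<noteq> 0)"

definition contact_form ::
  "('a::topological_space, 'm::finite) chart set \<Rightarrow> nat \<Rightarrow> ('a \<Rightarrow> 'a tvec \<Rightarrow> real) \<Rightarrow> bool" where
  "contact_form \<A> n \<eta> \<longleftrightarrow>
     one_form \<A> \<eta> \<and>
     (\<forall>p. form_nonzero_at \<A> (2 * n + 1)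
        (wedge 1 (2 * n) (form_of_one_form \<eta>) (wedge_power2 (ext_deriv \<eta>) n)) p)"

end

theory Submission
  imports Defs
begin

text \<open>
  Put \<open>A X = \<nabla>\<^sub>X \<xi>\<close>. The defining identity with \<open>Y = \<xi>\<close> reads \<open>\<nabla>\<^sub>\<xi> \<phi> = \<phi> (A + \<phi>)\<close>.
  Since \<open>\<nabla>\<^sub>\<xi> \<phi>\<close> is skew-symmetric, \<open>g (A X, \<phi> Y) + g (A Y, \<phi> X) = - 2 g (\<phi> X, \<phi> Y)\<close>; since it
  anticommutes with \<open>\<phi>\<close>, \<open>\<phi> A \<phi> = A + 2 \<phi>\<close>. Both together make \<open>A\<close> skew-symmetric, i.e. \<open>\<xi>\<close> is a
  Killing field, whence \<open>d\<eta>(X, Y) = 2 g (A X, Y)\<close> and \<open>d\<eta>(X, \<phi> X) = - 2 g (\<phi> X, \<phi> X)\<close>. So \<open>d\<eta>\<close> is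
  nondegenerate on the kernel of \<open>\<eta>\<close>, and \<open>\<eta> \<and> (d\<eta>)\<^sup>n\<close> does not vanish on a frame consisting of \<open>\<xi>\<close>
  and a symplectic basis of that kernel: all nonzero terms of the sum over permutations are positive.
\<close>


section \<open>Smooth maps\<close>

text \<open>\<open>levi_civita_connection\<close> and \<open>form_nonzero_at\<close> speak of vector
  fields on the whole manifold, while nondegeneracy and symplectic bases live in one tangent space.
  They are joined by a family \<open>V v\<close> of global fields, linear in the coordinate vector
  \<open>v\<close>, whose values at \<open>p\<close> run bijectively through the tangent space.
  These fields are coordinate directions cut off by a bump function; hence the smooth calculus at
  the beginning. Pulled back along \<open>V\<close>, the form d\<eta> at p is a bilinear form
  \<open>B\<close> on \<open>real ^ 'm\<close> and \<eta> is a functional, so the frame is found by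
  linear algebra in a Euclidean space. Positivity has a combinatorial source: on the frame, a
  permutation contributes only if it fixes 0 and sends pairs {2i+1, 2i+2} to such pairs. Permuting
  whole pairs is even, and each reversed pair changes both the sign of the permutation and one
  factor of the product, so the two signs cancel.\<close>

lemma has_derivative_frechet:
  assumes "open S" "f differentiable_on S" "x \<in> S"
  shows "(f has_derivative frechet_derivative f (at x)) (at x)"
  using assms differentiable_on_eq_differentiable_at frechet_derivative_works by blast

text \<open>Openness matters because \<open>frechet_derivative\<close> is taken in the full space:
  agreement on \<open>S\<close> passes to derivatives only at interior points.\<close>

lemma k_smooth_on_cong:
  assumes "open S" "k_smooth_on k S f" "\<And>x. x \<in> S \<Longrightarrow> f x = g x"
  shows "k_smooth_on k S g"
  using assms(2,3)
proof (induction k arbitrary: f g)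
  case 0
  then show ?case by (simp cong: continuous_on_cong)
next
  case (Suc k)
  have d: "(g has_derivative frechet_derivative f (at x)) (at x)" if "x \<in> S" for x
    using has_derivative_frechet[OF assms(1) _ that] Suc.prems that assms(1)
    by (metis has_derivative_transform_within_open k_smooth_on.simps(2))
  have eq: "frechet_derivative f (at x) = frechet_derivative g (at x)" if "x \<in> S" for x
    using d[OF that] frechet_derivative_at by blast
  have "g differentiable_on S"
    using d by (meson differentiableI differentiable_at_imp_differentiable_on)
  moreover have "k_smooth_on k S (\<lambda>x. frechet_derivative g (at x) v)" for v
    by (rule Suc.IH[of "\<lambda>x. frechet_derivative f (at x) v"]) (use Suc.prems eq in auto)
  ultimately show ?case by simp
qed

text \<open>Replaces the chosen \<open>frechet_derivative\<close> by any explicit derivative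
  formula; the closure properties below feed their calculus rules through it.\<close>

lemma k_smooth_on_SucI:
  assumes "open S" "\<And>x. x \<in> S \<Longrightarrow> (f has_derivative f' x) (at x)"
    and "\<And>v. k_smooth_on k S (\<lambda>x. f' x v)"
  shows "k_smooth_on (Suc k) S f"
proof -
  have "f differentiable_on S"
    using assms(2) by (meson differentiableI differentiable_at_imp_differentiable_on)
  moreover have "k_smooth_on k S (\<lambda>x. frechet_derivative f (at x) v)" for v
    by (rule k_smooth_on_cong[OF assms(1,3)]) (simp add: frechet_derivative_at[OF assms(2)])
  ultimately show ?thesis by simp
qed

lemma k_smooth_on_SucD: "k_smooth_on (Suc k) S f \<Longrightarrow> k_smooth_on k S f"
proof (induction k arbitrary: f)
  case 0
  then show ?case by (simp add: differentiable_imp_continuous_on)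
qed (metis k_smooth_on.simps(2))

lemma k_smooth_on_subset: "k_smooth_on k S f \<Longrightarrow> T \<subseteq> S \<Longrightarrow> k_smooth_on k T f"
  by (induction k arbitrary: f) (auto intro: continuous_on_subset differentiable_on_subset)

lemma k_smooth_on_Un:
  assumes "open S" "open T" "k_smooth_on k S f" "k_smooth_on k T f"
  shows "k_smooth_on k (S \<union> T) f"
  using assms(3,4)
proof (induction k arbitrary: f)
  case 0
  then show ?case using assms(1,2) by (simp add: continuous_on_open_Un)
next
  case (Suc k)
  have "f differentiable_on (S \<union> T)"
    using Suc.prems assms(1,2)
    by (simp add: differentiable_on_eq_differentiable_at open_Un ball_Un)
  then show ?case using Suc by simp
qed

lemma k_smooth_on_const: "open S \<Longrightarrow> k_smooth_on k S (\<lambda>x. c)"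
proof (induction k arbitrary: c)
  case (Suc k)
  show ?case
    by (rule k_smooth_on_SucI[where f' = "\<lambda>x v. 0"]) (use Suc in simp_all)
qed simp

lemma k_smooth_on_bounded_linear:
  assumes "bounded_linear L" "open S"
  shows "k_smooth_on k S L"
proof (cases k)
  case 0
  then show ?thesis using assms(1) by (simp add: linear_continuous_on)
next
  case (Suc j)
  then show ?thesis
    using k_smooth_on_SucI[where f' = "\<lambda>x. L" and f = L] assms
    by (simp add: bounded_linear_imp_has_derivative k_smooth_on_const)
qed

lemma k_smooth_on_linear_comp:
  assumes "bounded_linear L" "open S" "k_smooth_on k S f"
  shows "k_smooth_on k S (\<lambda>x. L (f x))"
  using assms(3)
proof (induction k arbitrary: f)
  case 0
  then show ?case using assms(1)
    by (simp add: bounded_linear.continuous_on)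
next
  case (Suc k)
  have "k_smooth_on k S (\<lambda>x. L (frechet_derivative f (at x) v))" for v
    using Suc by simp
  moreover have "((\<lambda>x. L (f x)) has_derivative (\<lambda>v. L (frechet_derivative f (at x) v))) (at x)"
    if "x \<in> S" for x
    using Suc.prems that
    by (intro bounded_linear.has_derivative[OF assms(1)] has_derivative_frechet[OF assms(2)]) simp_all
  ultimately show ?case
    by (intro k_smooth_on_SucI[OF assms(2)])
qed

lemma k_smooth_on_add:
  assumes "open S" "k_smooth_on k S f" "k_smooth_on k S g"
  shows "k_smooth_on k S (\<lambda>x. f x + g x)"
  using assms(2,3)
proof (induction k arbitrary: f g)
  case 0
  then show ?case by (simp add: continuous_on_add)
next
  case (Suc k)
  have "k_smooth_on k S (\<lambda>x. frechet_derivative f (at x) v + frechet_derivative g (at x) v)" for v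
    using Suc by simp
  moreover have "((\<lambda>x. f x + g x) has_derivative
      (\<lambda>v. frechet_derivative f (at x) v + frechet_derivative g (at x) v)) (at x)" if "x \<in> S" for x
    using Suc.prems that by (intro has_derivative_add has_derivative_frechet[OF assms(1)]) simp_all
  ultimately show ?case
    by (intro k_smooth_on_SucI[OF assms(1)])
qed

lemma k_smooth_on_sum:
  assumes "open S" "\<And>i. i \<in> I \<Longrightarrow> k_smooth_on k S (f i)"
  shows "k_smooth_on k S (\<lambda>x. \<Sum>i\<in>I. f i x)"
  using assms(2)
  by (induction I rule: infinite_finite_induct)
    (auto simp: assms(1) k_smooth_on_const k_smooth_on_add)

text \<open>The induction only uses the product rule, so a general bilinear product covers both
  scaling and the inner product.\<close>

lemma (in bounded_bilinear) k_smooth_on_prod: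
  fixes S :: "'v::euclidean_space set"
  assumes "open S" "k_smooth_on k S f" "k_smooth_on k S g"
  shows "k_smooth_on k S (\<lambda>x. prod (f x) (g x))"
  using assms(2,3)
proof (induction k arbitrary: f g)
  case 0
  then show ?case by (simp add: continuous_on)
next
  case (Suc k)
  note prems = Suc.prems
  have "k_smooth_on k S (\<lambda>x. prod (f x) (frechet_derivative g (at x) v)
      + prod (frechet_derivative f (at x) v) (g x))" for v
    using prems k_smooth_on_SucD[OF prems(1)] k_smooth_on_SucD[OF prems(2)]
    by (intro k_smooth_on_add assms(1) Suc.IH) simp_all
  moreover have "((\<lambda>x. prod (f x) (g x)) has_derivative (\<lambda>v. prod (f x) (frechet_derivative g (at x) v)
      + prod (frechet_derivative f (at x) v) (g x))) (at x)" if "x \<in> S" for x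
    using prems that by (intro FDERIV has_derivative_frechet[OF assms(1)]) auto
  ultimately show ?case
    by (intro k_smooth_on_SucI[OF assms(1)])
qed

text \<open>\<open>k_smooth_on\<close> controls the derivative of \<open>g\<close> in fixed
  directions only, but the chain rule feeds it the moving direction \<open>?f' x v\<close>.
  Expanding that direction in \<open>Basis\<close> leaves a finite sum of products, to which the
  induction hypothesis applies.\<close>

lemma k_smooth_on_compose:
  fixes f :: "'v::euclidean_space \<Rightarrow> 'w::euclidean_space"
  assumes "open S" "open T" "f ` S \<subseteq> T" "k_smooth_on k S f" "k_smooth_on k T g"
  shows "k_smooth_on k S (g \<circ> f)"
  using assms(4,5)
proof (induction k arbitrary: g)
  case 0
  then show ?case using assms(3) continuous_on_compose continuous_on_subset
    by (metis k_smooth_on.simps(1))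
next
  case (Suc k)
  let ?f' = "\<lambda>x. frechet_derivative f (at x)" and ?g' = "\<lambda>y. frechet_derivative g (at y)"
  have g: "(g has_derivative ?g' y) (at y)" if "y \<in> T" for y
    using Suc.prems that by (intro has_derivative_frechet[OF assms(2)]) auto
  have f: "(f has_derivative ?f' x) (at x)" if "x \<in> S" for x
    using Suc.prems that by (intro has_derivative_frechet[OF assms(1)]) auto
  have "k_smooth_on k S (\<lambda>x. ?f' x v \<bullet> b)" for v b
    using Suc.prems(1) by (intro k_smooth_on_linear_comp[OF bounded_linear_inner_left] assms(1)) simp
  moreover have "k_smooth_on k S (\<lambda>x. ?g' (f x) b)" for b
    using Suc.IH[of "\<lambda>y. ?g' y b"] Suc.prems(2) k_smooth_on_SucD[OF Suc.prems(1)] by (simp add: o_def)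
  ultimately have "k_smooth_on k S (\<lambda>x. \<Sum>b\<in>Basis. (?f' x v \<bullet> b) *\<^sub>R (?g' (f x) b))" for v
    by (intro k_smooth_on_sum assms(1) bounded_bilinear.k_smooth_on_prod[OF bounded_bilinear_scaleR])
  then have "k_smooth_on k S (\<lambda>x. ?g' (f x) (?f' x v))" for v
  proof (rule k_smooth_on_cong[OF assms(1)])
    fix x assume "x \<in> S"
    then have "linear (?g' (f x))"
      using g assms(3) has_derivative_linear by blast
    then show "(\<Sum>b\<in>Basis. (?f' x v \<bullet> b) *\<^sub>R (?g' (f x) b)) = ?g' (f x) (?f' x v)"
      by (subst (2) euclidean_representation[symmetric]) (simp add: linear_sum linear_scale)
  qed
  then show ?case
  proof (rule k_smooth_on_SucI[OF assms(1), rotated])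
    fix x assume "x \<in> S"
    then show "((g \<circ> f) has_derivative (\<lambda>v. ?g' (f x) (?f' x v))) (at x)"
      using diff_chain_at[OF f g] assms(3) by (auto simp: o_def)
  qed
qed

lemma smooth_on_cong:
  "open S \<Longrightarrow> smooth_on S f \<Longrightarrow> (\<And>x. x \<in> S \<Longrightarrow> f x = g x) \<Longrightarrow> smooth_on S g"
  unfolding smooth_on_def using k_smooth_on_cong by blast

lemma smooth_on_subset: "smooth_on S f \<Longrightarrow> T \<subseteq> S \<Longrightarrow> smooth_on T f"
  unfolding smooth_on_def using k_smooth_on_subset by blast

lemma smooth_on_Un:
  "open S \<Longrightarrow> open T \<Longrightarrow> smooth_on S f \<Longrightarrow> smooth_on T f \<Longrightarrow> smooth_on (S \<union> T) f"
  unfolding smooth_on_def using k_smooth_on_Un by blast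

lemma smooth_on_const: "open S \<Longrightarrow> smooth_on S (\<lambda>x. c)"
  unfolding smooth_on_def using k_smooth_on_const by blast

lemma smooth_on_bounded_linear: "bounded_linear L \<Longrightarrow> open S \<Longrightarrow> smooth_on S L"
  unfolding smooth_on_def using k_smooth_on_bounded_linear by blast

lemma smooth_on_add:
  "open S \<Longrightarrow> smooth_on S f \<Longrightarrow> smooth_on S g \<Longrightarrow> smooth_on S (\<lambda>x. f x + g x)"
  unfolding smooth_on_def using k_smooth_on_add by blast

lemma smooth_on_scaleR:
  "open S \<Longrightarrow> smooth_on S f \<Longrightarrow> smooth_on S g \<Longrightarrow> smooth_on S (\<lambda>x. f x *\<^sub>R g x)"
  unfolding smooth_on_def using bounded_bilinear.k_smooth_on_prod[OF bounded_bilinear_scaleR] by blast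

lemma smooth_on_mult:
  fixes f g :: "'v::euclidean_space \<Rightarrow> real"
  shows "open S \<Longrightarrow> smooth_on S f \<Longrightarrow> smooth_on S g \<Longrightarrow> smooth_on S (\<lambda>x. f x * g x)"
  using smooth_on_scaleR[of S f g] by simp

lemma smooth_on_inner:
  "open S \<Longrightarrow> smooth_on S f \<Longrightarrow> smooth_on S g \<Longrightarrow> smooth_on S (\<lambda>x. f x \<bullet> g x)"
  unfolding smooth_on_def using bounded_bilinear.k_smooth_on_prod[OF bounded_bilinear_inner] by blast

lemma smooth_on_compose:
  fixes f :: "'v::euclidean_space \<Rightarrow> 'w::euclidean_space"
  shows "open S \<Longrightarrow> open T \<Longrightarrow> f ` S \<subseteq> T \<Longrightarrow> smooth_on S f \<Longrightarrow> smooth_on T g \<Longrightarrow> smooth_on S (g \<circ> f)"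
  unfolding smooth_on_def using k_smooth_on_compose by blast

lemma smooth_on_frechet_derivative:
  "smooth_on S f \<Longrightarrow> smooth_on S (\<lambda>x. frechet_derivative f (at x) v)"
  unfolding smooth_on_def using k_smooth_on.simps(2) by blast

lemma smooth_on_has_derivative:
  assumes "open S" "smooth_on S f" "x \<in> S"
  shows "(f has_derivative frechet_derivative f (at x)) (at x)"
  using assms has_derivative_frechet unfolding smooth_on_def by (meson k_smooth_on.simps(2))

section \<open>Flat functions and smooth bumps\<close>

lemma tendsto_poly_mult_exp_neg: "((\<lambda>s::real. poly R s * exp (- s)) \<longlongrightarrow> 0) at_top"
proof -
  have "((\<lambda>s::real. \<Sum>i\<le>degree R. coeff R i * (s ^ i / exp s)) \<longlongrightarrow> (\<Sum>i\<le>degree R. coeff R i * 0)) at_top"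
    by (intro tendsto_intros tendsto_power_div_exp_0)
  then show ?thesis
    by (simp add: poly_altdef sum_distrib_right exp_minus divide_inverse mult.assoc)
qed

text \<open>The classical exp (-1/t) extended by 0, with a polynomial factor in 1/t so that the
  family is closed under differentiation: the derivative turns P into X^2 (P - P').\<close>

definition flat :: "real poly \<Rightarrow> real \<Rightarrow> real" where
  "flat P t = (if t > 0 then poly P (1 / t) * exp (- (1 / t)) else 0)"

lemma has_field_derivative_flat:
  "(flat P has_field_derivative flat ([:0, 0, 1:] * (P - pderiv P)) t) (at t)"
proof -
  consider "t > 0" | "t < 0" | "t = 0" by linarith
  then show ?thesis
  proof cases
    case 1
    have "((\<lambda>t. poly P (1 / t) * exp (- (1 / t))) has_field_derivative
        flat ([:0, 0, 1:] * (P - pderiv P)) t) (at t)"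
      unfolding flat_def using 1
      by (auto intro!: derivative_eq_intros DERIV_chain2[OF poly_DERIV] simp: field_simps power2_eq_square)
    then show ?thesis
      by (rule has_field_derivative_transform_within_open[where S = "{0<..}"]) (use 1 in \<open>auto simp: flat_def\<close>)
  next
    case 2
    have "((\<lambda>t. 0) has_field_derivative flat ([:0, 0, 1:] * (P - pderiv P)) t) (at t)"
      using 2 by (simp add: flat_def)
    then show ?thesis
      by (rule has_field_derivative_transform_within_open[where S = "{..<0}"]) (use 2 in \<open>auto simp: flat_def\<close>)
  next
    case 3
    have "((\<lambda>h. flat P h / h) \<longlongrightarrow> 0) (at_left 0)"
      by (rule tendsto_eventually) (auto simp: flat_def eventually_at_filter)
    \<comment> \<open>The difference quotient divides by \<open>h\<close>, which raises the degree
      in 1/h by one; \<open>pCons 0 P\<close> absorbs this factor.\<close>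
    moreover have "((\<lambda>h. poly (pCons 0 P) (inverse h) * exp (- inverse h)) \<longlongrightarrow> 0) (at_right 0)"
      by (rule filterlim_compose[OF tendsto_poly_mult_exp_neg filterlim_inverse_at_top_right])
    then have "((\<lambda>h. flat P h / h) \<longlongrightarrow> 0) (at_right 0)"
      by (rule Lim_transform_eventually)
        (auto simp: flat_def eventually_at_filter field_simps)
    ultimately have "((\<lambda>h. flat P h / h) \<longlongrightarrow> 0) (at 0)"
      by (rule filterlim_split_at)
    then show ?thesis
      using 3 by (simp add: DERIV_def flat_def)
  qed
qed

lemma smooth_on_flat: "smooth_on UNIV (flat P)"
proof -
  have "k_smooth_on k UNIV (flat P)" for k
  proof (induction k arbitrary: P)
    case 0
    then show ?case
      using has_field_derivative_flat DERIV_continuous continuous_at_imp_continuous_on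
      by (metis k_smooth_on.simps(1))
  next
    case (Suc k)
    let ?Q = "[:0, 0, 1:] * (P - pderiv P)"
    have "k_smooth_on k UNIV (\<lambda>t. flat ?Q t * v)" for v
      by (intro k_smooth_on_linear_comp[OF bounded_linear_mult_left] open_UNIV Suc)
    moreover have "(flat P has_derivative (\<lambda>v. flat ?Q t * v)) (at t)" for t
      using has_field_derivative_flat has_field_derivative_def by blast
    ultimately show ?case
      by (intro k_smooth_on_SucI[OF open_UNIV])
  qed
  then show ?thesis by (simp add: smooth_on_def)
qed

lemma ex_smooth_bump:
  fixes a :: "'v::euclidean_space"
  assumes "r > 0"
  shows "\<exists>b :: 'v \<Rightarrow> real. smooth_on UNIV b \<and> b a > 0 \<and> (\<forall>x. x \<notin> cball a r \<longrightarrow> b x = 0)"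
proof (intro exI conjI allI impI)
  \<comment> \<open>Positive exactly in the open ball. Differences are written with \<open>+\<close>
    and \<open>(-1) *\<^sub>R\<close> to fit the closure rules for smooth maps.\<close>
  let ?q = "\<lambda>x. r\<^sup>2 + (-1) *\<^sub>R ((x + - a) \<bullet> (x + - a))"
  show "smooth_on UNIV (flat 1 \<circ> ?q)"
    by (intro smooth_on_compose[OF _ open_UNIV _ _ smooth_on_flat] smooth_on_add smooth_on_scaleR
        smooth_on_inner smooth_on_const smooth_on_bounded_linear[OF bounded_linear_ident]) simp_all
  show "(flat 1 \<circ> ?q) a > 0"
    using assms by (simp add: flat_def)
  show "(flat 1 \<circ> ?q) x = 0" if "x \<notin> cball a r" for x
  proof -
    have "r\<^sup>2 \<le> (norm (x - a))\<^sup>2"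
      using that assms by (intro power_mono) (auto simp: dist_norm norm_minus_commute)
    then show ?thesis
      by (simp add: flat_def power2_norm_eq_inner)
  qed
qed


section \<open>Tangent vectors and vector fields in charts\<close>

lemma topological_chartD:
  assumes "topological_chart (U, x)"
  shows "open U" "open (x ` U)" "continuous_on U x" "continuous_on (x ` U) (inv_into U x)"
    "q \<in> U \<Longrightarrow> inv_into U x (x q) = q"
  using assms by (auto simp: topological_chart_def homeomorphism_def)

lemma topological_chart_open_image:
  assumes "topological_chart (U, x)" "open W"
  shows "open (x ` (U \<inter> W))"
proof -
  have "x ` (U \<inter> W) = x ` U \<inter> inv_into U x -` W"
    using topological_chartD(5)[OF assms(1)] by auto
  then show ?thesis
    using continuous_open_preimage[OF topological_chartD(4,2)[OF assms(1)] assms(2)] by simp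
qed

locale smooth_manifold =
  fixes \<A> :: "('a::t2_space, 'm::finite) chart set"
  assumes smooth_atlas: "smooth_atlas \<A>"
begin

lemma chart: "(U, x) \<in> \<A> \<Longrightarrow> topological_chart (U, x)"
  using smooth_atlas by (auto simp: smooth_atlas_def)

lemma ex_chart:
  obtains U x where "(U, x) \<in> \<A>" "q \<in> U"
proof -
  have "q \<in> (\<Union>(U, x)\<in>\<A>. U)"
    using smooth_atlas by (simp add: smooth_atlas_def)
  then show ?thesis using that by auto
qed

lemma smooth_transition:
  "(U, x) \<in> \<A> \<Longrightarrow> (V, y) \<in> \<A> \<Longrightarrow> smooth_on (x ` (U \<inter> V)) (y \<circ> inv_into U x)"
  using smooth_atlas by (fastforce simp: smooth_atlas_def)

lemma smooth_fun_chart: "smooth_fun \<A> f \<Longrightarrow> (U, x) \<in> \<A> \<Longrightarrow> smooth_on (x ` U) (f \<circ> inv_into U x)"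
  by (auto simp: smooth_fun_def)

lemma smooth_funI:
  "(\<And>U x. (U, x) \<in> \<A> \<Longrightarrow> open (x ` U) \<Longrightarrow> smooth_on (x ` U) (f \<circ> inv_into U x)) \<Longrightarrow> smooth_fun \<A> f"
  using topological_chartD(2)[OF chart] by (auto simp: smooth_fun_def)

lemma smooth_fun_const: "smooth_fun \<A> (\<lambda>p. c)"
  by (rule smooth_funI) (simp add: o_def smooth_on_const)

lemma smooth_fun_add:
  assumes "smooth_fun \<A> f" "smooth_fun \<A> g"
  shows "smooth_fun \<A> (\<lambda>p. f p + g p)"
proof (rule smooth_funI)
  fix U :: "'a set" and x :: "'a \<Rightarrow> real ^ 'm" assume c: "(U, x) \<in> \<A>" "open (x ` U)"
  show "smooth_on (x ` U) ((\<lambda>p. f p + g p) \<circ> inv_into U x)"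
    using smooth_on_add[OF c(2) smooth_fun_chart[OF assms(1) c(1)] smooth_fun_chart[OF assms(2) c(1)]]
    by (simp add: o_def)
qed

lemma smooth_fun_mult:
  assumes "smooth_fun \<A> f" "smooth_fun \<A> g"
  shows "smooth_fun \<A> (\<lambda>p. f p * g p)"
proof (rule smooth_funI)
  fix U :: "'a set" and x :: "'a \<Rightarrow> real ^ 'm" assume c: "(U, x) \<in> \<A>" "open (x ` U)"
  show "smooth_on (x ` U) ((\<lambda>p. f p * g p) \<circ> inv_into U x)"
    using smooth_on_mult[OF c(2) smooth_fun_chart[OF assms(1) c(1)] smooth_fun_chart[OF assms(2) c(1)]]
    by (simp add: o_def)
qed

text \<open>The default value 0 copies that of \<open>velocity\<close>, so that both sides can be
  equal as operators and not merely on smooth functions.\<close>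

definition chart_dir :: "('a, 'm) chart \<Rightarrow> 'a \<Rightarrow> real ^ 'm \<Rightarrow> 'a tvec" where
  "chart_dir = (\<lambda>(U, x) q v f.
     if smooth_fun \<A> f then frechet_derivative (f \<circ> inv_into U x) (at (x q)) v else 0)"

lemma smooth_fun_has_derivative:
  assumes "smooth_fun \<A> f" "(U, x) \<in> \<A>" "q \<in> U"
  shows "((f \<circ> inv_into U x) has_derivative (\<lambda>v. chart_dir (U, x) q v f)) (at (x q))"
  using smooth_on_has_derivative[OF _ smooth_fun_chart[OF assms(1,2)], of "x q"] assms
    topological_chartD(2)[OF chart[OF assms(2)]]
  by (simp add: chart_dir_def)

lemma chart_dir_linear:
  assumes "(U, x) \<in> \<A>" "q \<in> U"
  shows "chart_dir (U, x) q (a *\<^sub>R v + b *\<^sub>R w)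
    = (\<lambda>f. a * chart_dir (U, x) q v f + b * chart_dir (U, x) q w f)"
proof
  fix f
  show "chart_dir (U, x) q (a *\<^sub>R v + b *\<^sub>R w) f
    = a * chart_dir (U, x) q v f + b * chart_dir (U, x) q w f"
  proof (cases "smooth_fun \<A> f")
    case True
    have "linear (\<lambda>v. chart_dir (U, x) q v f)"
      using smooth_fun_has_derivative[OF True assms] by (rule has_derivative_linear)
    then show ?thesis by (simp add: linear_iff)
  qed (simp add: chart_dir_def)
qed

lemma velocity_eq_chart_dir:
  assumes c: "(U, x) \<in> \<A>" and q: "\<gamma> 0 \<in> U"
    and ev: "\<forall>\<^sub>F t in nhds 0. \<gamma> t \<in> U" and L: "((x \<circ> \<gamma>) has_derivative L) (at 0)"
  shows "velocity \<A> \<gamma> = chart_dir (U, x) (\<gamma> 0) (L 1)"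
proof
  fix f
  show "velocity \<A> \<gamma> f = chart_dir (U, x) (\<gamma> 0) (L 1) f"
  proof (cases "smooth_fun \<A> f")
    case True
    let ?D = "\<lambda>v. chart_dir (U, x) (\<gamma> 0) v f"
    have D: "((f \<circ> inv_into U x) has_derivative ?D) (at ((x \<circ> \<gamma>) 0))"
      using smooth_fun_has_derivative[OF True c q] by simp
    have "((f \<circ> inv_into U x) \<circ> (x \<circ> \<gamma>) has_derivative ?D \<circ> L) (at 0)"
      by (rule diff_chain_at[OF L D])
    moreover from ev obtain S where S: "open S" "0 \<in> S" "\<forall>t\<in>S. \<gamma> t \<in> U"
      by (auto simp: eventually_nhds)
    moreover have "((f \<circ> inv_into U x) \<circ> (x \<circ> \<gamma>)) t = (f \<circ> \<gamma>) t" if "t \<in> S" for t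
      using S(3) that by (simp add: topological_chartD(5)[OF chart[OF c]])
    ultimately have "(f \<circ> \<gamma> has_derivative ?D \<circ> L) (at 0)"
      using has_derivative_transform_within_open by blast
    moreover have "?D \<circ> L = (*) (?D (L 1))"
    proof
      fix t
      have lin: "linear ?D" "linear L"
        using D L has_derivative_linear by blast+
      then have "?D (L (t *\<^sub>R 1)) = t *\<^sub>R ?D (L 1)"
        by (simp only: linear_scale[OF lin(2)] linear_scale[OF lin(1)])
      then show "(?D \<circ> L) t = ?D (L 1) * t" by simp
    qed
    ultimately have "(f \<circ> \<gamma> has_field_derivative ?D (L 1)) (at 0)"
      by (simp add: has_field_derivative_def)
    then show ?thesis
      using True by (simp add: velocity_def DERIV_imp_deriv)
  qed (simp add: velocity_def chart_dir_def)
qed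

lemma coordinate_line:
  fixes x :: "'a \<Rightarrow> real ^ 'm"
  assumes c: "(U, x) \<in> \<A>" and q: "q \<in> U"
  obtains \<epsilon> where "\<epsilon> > 0" "smooth_curve \<A> \<epsilon> (\<lambda>t. inv_into U x (x q + t *\<^sub>R v))"
    "\<And>t. t \<in> {-\<epsilon><..<\<epsilon>} \<Longrightarrow> x q + t *\<^sub>R v \<in> x ` U"
proof -
  note C = topological_chartD[OF chart[OF c]]
  let ?l = "\<lambda>t::real. x q + t *\<^sub>R v" and ?\<gamma> = "\<lambda>t. inv_into U x (x q + t *\<^sub>R v)"
  have "open (?l -` (x ` U))"
    by (intro open_vimage C(2) continuous_intros)
  moreover have "0 \<in> ?l -` (x ` U)" using q by simp
  ultimately obtain \<epsilon> where \<epsilon>: "\<epsilon> > 0" "ball 0 \<epsilon> \<subseteq> ?l -` (x ` U)"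
    using open_contains_ball by blast
  define I where "I = {-\<epsilon><..<\<epsilon>}"
  have l: "?l t \<in> x ` U" if "t \<in> I" for t
  proof -
    have "t \<in> ball 0 \<epsilon>" using that by (auto simp: I_def)
    then show ?thesis using \<epsilon>(2) by blast
  qed
  have cont: "continuous_on I ?\<gamma>"
    by (rule continuous_on_compose2[OF C(4)]) (use l in \<open>auto intro!: continuous_intros\<close>)
  have "smooth_on (I \<inter> ?\<gamma> -` V) (y \<circ> ?\<gamma>)" if d: "(V, y) \<in> \<A>" for V y
  proof -
    have "open (I \<inter> ?\<gamma> -` V)"
      using cont topological_chartD(1)[OF chart[OF d]]
      by (intro continuous_open_preimage) (auto simp: I_def)
    moreover have "?l ` (I \<inter> ?\<gamma> -` V) \<subseteq> x ` (U \<inter> V)"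
    proof clarify
      fix t assume t: "t \<in> I" "?\<gamma> t \<in> V"
      then have "?\<gamma> t \<in> U" "x (?\<gamma> t) = ?l t"
        using l by (auto intro: inv_into_into f_inv_into_f)
      then show "?l t \<in> x ` (U \<inter> V)" using t by force
    qed
    moreover have "open (x ` (U \<inter> V))"
      by (intro topological_chart_open_image chart c topological_chartD(1)[OF chart[OF d]])
    moreover have "smooth_on (I \<inter> ?\<gamma> -` V) ?l" if "open (I \<inter> ?\<gamma> -` V)"
      using that by (intro smooth_on_add smooth_on_const smooth_on_bounded_linear bounded_linear_scaleR_left)
    ultimately have "smooth_on (I \<inter> ?\<gamma> -` V) ((y \<circ> inv_into U x) \<circ> ?l)"
      using smooth_on_compose smooth_transition[OF c d] by blast
    then show ?thesis by (simp add: o_def)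
  qed
  then have "smooth_curve \<A> \<epsilon> ?\<gamma>"
    using cont by (auto simp: smooth_curve_def I_def)
  then show ?thesis using that \<epsilon>(1) l by (auto simp: I_def)
qed

text \<open>Velocities of curves have no evident sum; as the range of a linear map, the tangent
  space becomes a vector space. One inclusion is the chain rule, the other takes the velocity of a
  coordinate line.\<close>

lemma tangent_space_eq_range:
  assumes c: "(U, x) \<in> \<A>" and q: "q \<in> U"
  shows "tangent_space \<A> q = range (chart_dir (U, x) q)"
proof (intro set_eqI iffI)
  note C = topological_chartD[OF chart[OF c]]
  fix u assume "u \<in> tangent_space \<A> q"
  then obtain \<gamma> \<epsilon> where \<gamma>: "u = velocity \<A> \<gamma>" "\<epsilon> > 0" "smooth_curve \<A> \<epsilon> \<gamma>" "\<gamma> 0 = q"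
    by (auto simp: tangent_space_def)
  let ?S = "{-\<epsilon><..<\<epsilon>} \<inter> \<gamma> -` U"
  have S: "open ?S" "0 \<in> ?S"
    using \<gamma> q by (auto simp: smooth_curve_def intro!: continuous_open_preimage C(1))
  then have "((x \<circ> \<gamma>) has_derivative frechet_derivative (x \<circ> \<gamma>) (at 0)) (at 0)"
    using \<gamma>(3) c by (intro smooth_on_has_derivative[of ?S]) (auto simp: smooth_curve_def)
  moreover have "\<forall>\<^sub>F t in nhds 0. \<gamma> t \<in> U"
    using eventually_nhds_in_open[OF S] by eventually_elim simp
  ultimately show "u \<in> range (chart_dir (U, x) q)"
    using velocity_eq_chart_dir[OF c] q \<gamma> by blast
next
  note C = topological_chartD[OF chart[OF c]]
  fix u assume "u \<in> range (chart_dir (U, x) q)"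
  then obtain v where v: "u = chart_dir (U, x) q v" by blast
  let ?l = "\<lambda>t::real. x q + t *\<^sub>R v" and ?\<gamma> = "\<lambda>t. inv_into U x (x q + t *\<^sub>R v)"
  obtain \<epsilon> where \<epsilon>: "\<epsilon> > 0" "smooth_curve \<A> \<epsilon> ?\<gamma>" "\<And>t. t \<in> {-\<epsilon><..<\<epsilon>} \<Longrightarrow> ?l t \<in> x ` U"
    using coordinate_line[OF c q, of v] by blast
  have "\<forall>\<^sub>F t in nhds 0. t \<in> {-\<epsilon><..<\<epsilon>}"
    using \<epsilon>(1) by (intro eventually_nhds_in_open) auto
  then have ev: "\<forall>\<^sub>F t in nhds 0. ?l t \<in> x ` U"
    using \<epsilon>(3) by (rule eventually_mono)
  have \<gamma>0: "?\<gamma> 0 = q" using C(5)[OF q] by simp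
  have "(?l has_derivative (\<lambda>t. t *\<^sub>R v)) (at 0)"
    by (auto intro!: derivative_eq_intros)
  then have "((x \<circ> ?\<gamma>) has_derivative (\<lambda>t. t *\<^sub>R v)) (at 0)"
  proof (rule has_derivative_transform_within_open[where s = "{-\<epsilon><..<\<epsilon>}"])
    fix t assume "t \<in> {-\<epsilon><..<\<epsilon>}"
    then show "?l t = (x \<circ> ?\<gamma>) t"
      using \<epsilon>(3) by (simp add: f_inv_into_f)
  qed (use \<epsilon>(1) in auto)
  moreover have "\<forall>\<^sub>F t in nhds 0. ?\<gamma> t \<in> U"
    using ev by eventually_elim (rule inv_into_into)
  ultimately have "velocity \<A> ?\<gamma> = chart_dir (U, x) (?\<gamma> 0) (1 *\<^sub>R v)"
    using \<gamma>0 q by (intro velocity_eq_chart_dir[OF c]) simp_all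
  then have "u = velocity \<A> ?\<gamma>"
    using v \<gamma>0 by simp
  then show "u \<in> tangent_space \<A> q"
    using \<epsilon>(1,2) \<gamma>0 unfolding tangent_space_def by blast
qed

lemma tangent_space_comb:
  assumes "u \<in> tangent_space \<A> q" "w \<in> tangent_space \<A> q"
  shows "(\<lambda>f. a * u f + b * w f) \<in> tangent_space \<A> q"
proof -
  obtain U x where c: "(U, x) \<in> \<A>" "q \<in> U" by (rule ex_chart)
  show ?thesis
    using assms chart_dir_linear[OF c, symmetric] by (auto simp: tangent_space_eq_range[OF c])
qed

lemma tangent_space_zero: "(\<lambda>f. 0) \<in> tangent_space \<A> q"
proof -
  obtain U x where c: "(U, x) \<in> \<A>" "q \<in> U" by (rule ex_chart)
  have "chart_dir (U, x) q 0 \<in> tangent_space \<A> q"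
    by (simp add: tangent_space_eq_range[OF c])
  then show ?thesis using tangent_space_comb[of _ q _ 0 0] by fastforce
qed

lemma tangent_vector_const: "u \<in> tangent_space \<A> q \<Longrightarrow> u (\<lambda>p. c) = 0"
  by (auto simp: tangent_space_def velocity_def o_def)

lemma vector_fieldD: "X \<in> vector_fields \<A> \<Longrightarrow> X p \<in> tangent_space \<A> p"
  by (simp add: vector_fields_def)

lemma vector_fields_comb:
  assumes "X \<in> vector_fields \<A>" "Y \<in> vector_fields \<A>" "smooth_fun \<A> h" "smooth_fun \<A> k"
  shows "(\<lambda>p f. h p * X p f + k p * Y p f) \<in> vector_fields \<A>"
  using assms by (auto simp: vector_fields_def intro!: tangent_space_comb smooth_fun_add smooth_fun_mult)

section \<open>Extending local functions and coordinate fields to the whole manifold\<close>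

lemma smooth_fun_extend:
  fixes x :: "'a \<Rightarrow> real ^ 'm"
  assumes c: "(U, x) \<in> \<A>" and r: "cball a r \<subseteq> x ` U" and F: "smooth_on (x ` U) F"
    and F0: "\<And>z. z \<notin> cball a r \<Longrightarrow> F z = 0"
  shows "smooth_fun \<A> (\<lambda>q. if q \<in> U then F (x q) else 0)" (is "smooth_fun \<A> ?f")
proof (rule smooth_funI)
  note C = topological_chartD[OF chart[OF c]]
  fix V :: "'a set" and y :: "'a \<Rightarrow> real ^ 'm" assume d: "(V, y) \<in> \<A>"
  note D = topological_chartD[OF chart[OF d]]
  \<comment> \<open>The Hausdorff property makes this compact set closed. Any chart domain
    \<open>V\<close> is then covered by two open sets: its part in \<open>U\<close>, where the
    function is \<open>F\<close> in coordinates, and its part off \<open>?K\<close>, where the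
    function is 0.\<close>
  let ?K = "inv_into U x ` cball a r"
  have "compact ?K"
    by (intro compact_continuous_image continuous_on_subset[OF C(4) r] compact_cball)
  then have K: "open (- ?K)" by (simp add: compact_imp_closed open_Compl)
  have out: "F (x q) = 0" if "q \<in> U" "q \<notin> ?K" for q
    using F0 that C(5) by (metis imageI)
  have o: "open (y ` (V \<inter> U))" "open (y ` (V \<inter> - ?K))"
    by (intro topological_chart_open_image chart d C(1) K)+
  have "smooth_on (y ` (V \<inter> U)) (F \<circ> (x \<circ> inv_into V y))"
    by (rule smooth_on_compose[OF o(1) C(2) _ smooth_transition[OF d c] F]) (auto simp: D(5))
  then have "smooth_on (y ` (V \<inter> U)) (?f \<circ> inv_into V y)"
    by (rule smooth_on_cong[OF o(1)]) (auto simp: D(5))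
  moreover have "smooth_on (y ` (V \<inter> - ?K)) (?f \<circ> inv_into V y)"
    by (rule smooth_on_cong[OF o(2) smooth_on_const[OF o(2), of 0]]) (auto simp: D(5) out)
  ultimately have "smooth_on (y ` (V \<inter> U) \<union> y ` (V \<inter> - ?K)) (?f \<circ> inv_into V y)"
    by (intro smooth_on_Un o)
  moreover have "y ` (V \<inter> U) \<union> y ` (V \<inter> - ?K) = y ` V"
    using r inv_into_into[of _ x U] by blast
  ultimately show "smooth_on (y ` V) (?f \<circ> inv_into V y)" by simp
qed

text \<open>Linearity in \<open>v\<close> holds on the whole manifold, whereas bijectivity onto the
  tangent space is claimed only at \<open>p\<close>, where the bump is positive.\<close>

lemma ex_vector_fields_spanning:
  obtains V :: "real ^ 'm \<Rightarrow> 'a vfield" where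
    "\<And>v. V v \<in> vector_fields \<A>"
    "\<And>a v b w. V (a *\<^sub>R v + b *\<^sub>R w) = (\<lambda>q f. a * V v q f + b * V w q f)"
    "\<And>u. u \<in> tangent_space \<A> p \<Longrightarrow> \<exists>v. u = V v p"
    "\<And>v. V v p = (\<lambda>f. 0) \<Longrightarrow> v = 0"
proof -
  obtain U x where c: "(U, x) \<in> \<A>" "p \<in> U" by (rule ex_chart)
  note C = topological_chartD[OF chart[OF c(1)]]
  obtain r where r: "r > 0" "cball (x p) r \<subseteq> x ` U"
    using C(2)[unfolded open_contains_cball] c(2) by (meson imageI)
  obtain b :: "real ^ 'm \<Rightarrow> real" where b: "smooth_on UNIV b" "b (x p) > 0" "\<forall>z. z \<notin> cball (x p) r \<longrightarrow> b z = 0"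
    using ex_smooth_bump[OF r(1)] by blast
  \<comment> \<open>A coordinate field with constant coefficients, multiplied by the bump and
    extended by 0.\<close>
  define V where "V = (\<lambda>v q f. if q \<in> U then b (x q) * chart_dir (U, x) q v f else 0)"
  have bU: "smooth_on (x ` U) b" using b(1) smooth_on_subset by blast
  show ?thesis
  proof (rule that)
    show "V v \<in> vector_fields \<A>" for v
      unfolding vector_fields_def
    proof (safe)
      fix q
      show "V v q \<in> tangent_space \<A> q"
      proof (cases "q \<in> U")
        case True
        then have "(\<lambda>f. b (x q) * chart_dir (U, x) q v f + 0 * chart_dir (U, x) q v f) \<in> tangent_space \<A> q"
          by (intro tangent_space_comb) (auto simp: tangent_space_eq_range[OF c(1)])
        then show ?thesis using True by (simp add: V_def)
      next
        case False
        then show ?thesis using tangent_space_zero by (simp add: V_def)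
      qed
    next
      fix f assume f: "smooth_fun \<A> f"
      have "smooth_on (x ` U) (\<lambda>z. b z * frechet_derivative (f \<circ> inv_into U x) (at z) v)"
        by (intro smooth_on_mult C(2) bU smooth_on_frechet_derivative smooth_fun_chart[OF f c(1)])
      then have "smooth_fun \<A> (\<lambda>q. if q \<in> U then b (x q) * frechet_derivative (f \<circ> inv_into U x) (at (x q)) v else 0)"
        by (rule smooth_fun_extend[OF c(1) r(2)]) (use b(3) in simp)
      then show "smooth_fun \<A> (\<lambda>q. V v q f)"
        using f by (simp add: V_def chart_dir_def cong: if_cong)
    qed
    show "V (s *\<^sub>R v + t *\<^sub>R w) = (\<lambda>q f. s * V v q f + t * V w q f)" for s v t w
      by (intro ext) (auto simp: V_def chart_dir_linear[OF c(1)] algebra_simps)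
    show "\<exists>v. u = V v p" if u: "u \<in> tangent_space \<A> p" for u
    proof -
      obtain w where w: "u = chart_dir (U, x) p w"
        using u by (auto simp: tangent_space_eq_range[OF c])
      \<comment> \<open>Dividing by the value of the bump at \<open>p\<close> undoes the cut-off;
        the zero summand gives the argument the shape of \<open>chart_dir_linear\<close>.\<close>
      have "V ((1 / b (x p)) *\<^sub>R w + 0 *\<^sub>R w) p = u"
        unfolding V_def chart_dir_linear[OF c] using c(2) b(2) w by simp
      then show ?thesis by metis
    qed
    show "v = 0" if "V v p = (\<lambda>f. 0)" for v
    proof -
      \<comment> \<open>To recover \<open>v\<close> from the operator, a globally smooth test
        function is required, so the linear functional is cut off as well. It is centred at
        \<open>x p\<close>, hence the derivative of the bump drops out of the product rule
        there.\<close>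
      let ?F = "\<lambda>z. b z * ((z + - x p) \<bullet> v)"
      let ?f = "\<lambda>q. if q \<in> U then ?F (x q) else 0"
      have F: "smooth_on (x ` U) ?F"
        by (intro smooth_on_mult bU C(2) smooth_on_inner smooth_on_add smooth_on_const
            smooth_on_bounded_linear bounded_linear_ident)
      then have f: "smooth_fun \<A> ?f"
        by (rule smooth_fun_extend[OF c(1) r(2)]) (use b(3) in simp)
      let ?b' = "frechet_derivative b (at (x p))"
      have b': "(b has_derivative ?b') (at (x p))"
        using smooth_on_has_derivative[OF open_UNIV b(1)] by simp
      have "(?F has_derivative (\<lambda>w. b (x p) * (w \<bullet> v))) (at (x p))"
        by (rule derivative_eq_intros b' refl)+ simp
      then have "(?f \<circ> inv_into U x has_derivative (\<lambda>w. b (x p) * (w \<bullet> v))) (at (x p))"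
        by (rule has_derivative_transform_within_open[OF _ C(2)]) (use c(2) C(5) in auto)
      then have "chart_dir (U, x) p v ?f = b (x p) * (v \<bullet> v)"
        using has_derivative_unique[OF smooth_fun_has_derivative[OF f c]] by (metis (no_types))
      moreover have "V v p ?f = 0" using that by simp
      ultimately have "b (x p) * (b (x p) * (v \<bullet> v)) = 0"
        using c(2) by (simp add: V_def)
      then show ?thesis using b(2) by simp
    qed
  qed
qed

end


section \<open>Nearly Sasakian structures\<close>

lemma (in smooth_manifold) tangent_vector_uminus:
  assumes "u \<in> tangent_space \<A> q" "smooth_fun \<A> f"
  shows "u (\<lambda>p. - f p) = - u f"
proof -
  obtain U x where c: "(U, x) \<in> \<A>" "q \<in> U" by (rule ex_chart)
  obtain v where v: "u = chart_dir (U, x) q v"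
    using assms(1) by (auto simp: tangent_space_eq_range[OF c])
  have "smooth_fun \<A> (\<lambda>p. - f p)"
    using smooth_fun_mult[OF smooth_fun_const[of "-1"] assms(2)] by simp
  then have "((\<lambda>z. - (f \<circ> inv_into U x) z) has_derivative (\<lambda>v. chart_dir (U, x) q v (\<lambda>p. - f p))) (at (x q))"
    using smooth_fun_has_derivative[OF _ c, of "\<lambda>p. - f p"] by (simp add: o_def)
  from has_derivative_unique[OF this has_derivative_minus[OF smooth_fun_has_derivative[OF assms(2) c]]]
  show ?thesis
    unfolding v by (rule fun_cong)
qed

locale nearly_sasakian_manifold = smooth_manifold \<A>
  for \<A> :: "('a::t2_space, 'm::finite) chart set" +
  fixes D :: "'a vfield \<Rightarrow> 'a vfield \<Rightarrow> 'a vfield"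
    and \<phi> :: "'a \<Rightarrow> 'a tvec \<Rightarrow> 'a tvec"
    and \<xi> :: "'a vfield"
    and \<eta> :: "'a \<Rightarrow> 'a tvec \<Rightarrow> real"
    and g :: "'a \<Rightarrow> 'a tvec \<Rightarrow> 'a tvec \<Rightarrow> real"
  assumes levi_civita: "levi_civita_connection \<A> g D"
    and nearly_sasakian: "nearly_sasakian \<A> D \<phi> \<xi> \<eta> g"
begin

abbreviation T :: "'a \<Rightarrow> 'a tvec set" where "T \<equiv> tangent_space \<A>"
abbreviation VF :: "'a vfield set" where "VF \<equiv> vector_fields \<A>"

section \<open>Pointwise algebra of the almost contact metric structure\<close>

lemma structure_tensors:
  shows endo: "endomorphism_field \<A> \<phi>" and xi_field: "\<xi> \<in> VF" and one_form: "one_form \<A> \<eta>"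
    and metric: "riemannian_metric \<A> g"
    and eta_xi: "\<eta> p (\<xi> p) = 1"
  using nearly_sasakian by (auto simp: nearly_sasakian_def almost_contact_metric_def)

lemma phi_phi: "u \<in> T p \<Longrightarrow> \<phi> p (\<phi> p u) = (\<lambda>f. \<eta> p u * \<xi> p f - u f)"
  and g_phi_phi: "u \<in> T p \<Longrightarrow> v \<in> T p \<Longrightarrow> g p (\<phi> p u) (\<phi> p v) = g p u v - \<eta> p u * \<eta> p v"
  using nearly_sasakian by (auto simp: nearly_sasakian_def almost_contact_metric_def)

lemma tangent_closed:
  assumes "u \<in> T p"
  shows T_scale: "(\<lambda>f. a * u f) \<in> T p"
    and T_add: "v \<in> T p \<Longrightarrow> (\<lambda>f. u f + v f) \<in> T p" and T_diff: "v \<in> T p \<Longrightarrow> (\<lambda>f. u f - v f) \<in> T p"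
    and T_phi: "\<phi> p u \<in> T p"
  using tangent_space_comb[of u p u a 0]
    tangent_space_comb[of u p v 1 1] tangent_space_comb[of u p v 1 "-1"] assms endo
  by (auto simp: endomorphism_field_def)

lemma T_field: "X \<in> VF \<Longrightarrow> X p \<in> T p"
  by (rule vector_fieldD)

lemma T_xi: "\<xi> p \<in> T p"
  by (rule T_field[OF xi_field])

lemma VF_D: "X \<in> VF \<Longrightarrow> Y \<in> VF \<Longrightarrow> D X Y \<in> VF"
  using levi_civita by (simp add: levi_civita_connection_def affine_connection_def)

lemma VF_phi: "X \<in> VF \<Longrightarrow> (\<lambda>p. \<phi> p (X p)) \<in> VF"
  using endo by (simp add: endomorphism_field_def)

lemma T_D: "X \<in> VF \<Longrightarrow> Y \<in> VF \<Longrightarrow> D X Y p \<in> T p"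
  by (intro T_field VF_D)

lemmas T_intros = T_scale T_add T_diff T_phi T_field T_xi T_D VF_D VF_phi xi_field
  tangent_space_zero

lemma g_sym: "u \<in> T p \<Longrightarrow> v \<in> T p \<Longrightarrow> g p u v = g p v u"
  using metric by (simp add: riemannian_metric_def)

lemma g_comb: "u \<in> T p \<Longrightarrow> v \<in> T p \<Longrightarrow> w \<in> T p \<Longrightarrow>
    g p (\<lambda>f. a * u f + b * v f) w = a * g p u w + b * g p v w"
  using metric by (simp add: riemannian_metric_def)

lemma g_linear_left:
  assumes "u \<in> T p" "w \<in> T p"
  shows g_scale: "g p (\<lambda>f. a * u f) w = a * g p u w"
    and g_add: "v \<in> T p \<Longrightarrow> g p (\<lambda>f. u f + v f) w = g p u w + g p v w"
    and g_diff: "v \<in> T p \<Longrightarrow> g p (\<lambda>f. u f - v f) w = g p u w - g p v w"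
    and g_zero: "g p (\<lambda>f. 0) w = 0"
  using g_comb[of u p u w a 0] g_comb[of u p u w 0 0]
    g_comb[of u p v w 1 1] g_comb[of u p v w 1 "-1"] assms
  by auto

lemma g_linear_right:
  assumes "u \<in> T p" "w \<in> T p"
  shows g_scale_right: "g p w (\<lambda>f. a * u f) = a * g p w u"
    and g_add_right: "v \<in> T p \<Longrightarrow> g p w (\<lambda>f. u f + v f) = g p w u + g p w v"
  using g_linear_left[OF assms] assms by (simp_all add: g_sym[of w] T_intros)

lemma phi_comb: "u \<in> T p \<Longrightarrow> v \<in> T p \<Longrightarrow>
    \<phi> p (\<lambda>f. a * u f + b * v f) = (\<lambda>f. a * \<phi> p u f + b * \<phi> p v f)"
  using endo by (simp add: endomorphism_field_def)

lemma phi_linear: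
  assumes "u \<in> T p"
  shows phi_scale: "\<phi> p (\<lambda>f. a * u f) = (\<lambda>f. a * \<phi> p u f)"
    and phi_add: "v \<in> T p \<Longrightarrow> \<phi> p (\<lambda>f. u f + v f) = (\<lambda>f. \<phi> p u f + \<phi> p v f)"
    and phi_diff: "v \<in> T p \<Longrightarrow> \<phi> p (\<lambda>f. u f - v f) = (\<lambda>f. \<phi> p u f - \<phi> p v f)"
    and phi_zero: "\<phi> p (\<lambda>f. 0) = (\<lambda>f. 0)"
  using phi_comb[of u p u a 0] phi_comb[of u p u 0 0]
    phi_comb[of u p v 1 1] phi_comb[of u p v 1 "-1"] assms
  by auto

lemma eta_comb: "u \<in> T p \<Longrightarrow> v \<in> T p \<Longrightarrow>
    \<eta> p (\<lambda>f. a * u f + b * v f) = a * \<eta> p u + b * \<eta> p v"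
  using one_form by (simp add: one_form_def)

text \<open>Let c = \<eta> (\<phi> \<xi>). Since \<phi> (\<phi> \<xi>) = 0, the formula for the
  square of \<phi> at \<phi> \<xi> gives \<phi> \<xi> = c \<xi>. Then 0 = \<phi> (\<phi> \<xi>) = c
  \<phi> \<xi>, and \<eta> of this is c^2.\<close>

lemma phi_xi: "\<phi> p (\<xi> p) = (\<lambda>f. 0)"
proof -
  let ?e = "\<xi> p" let ?c = "\<eta> p (\<phi> p ?e)"
  have pp: "\<phi> p (\<phi> p ?e) = (\<lambda>f. 0)"
    using phi_phi[OF T_xi, of p] by (simp add: eta_xi)
  then have "\<phi> p (\<phi> p (\<phi> p ?e)) = (\<lambda>f. 0)"
    by (simp add: phi_zero[OF T_xi])
  then have e: "\<phi> p ?e = (\<lambda>f. ?c * ?e f)"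
    using phi_phi[OF T_phi[OF T_xi], of p] by (simp add: fun_eq_iff)
  then have "\<phi> p (\<phi> p ?e) = (\<lambda>f. ?c * \<phi> p ?e f)"
    by (metis phi_scale[OF T_xi])
  then have "\<eta> p (\<phi> p (\<phi> p ?e)) = ?c * ?c"
    using eta_comb[of "\<phi> p ?e" p "\<phi> p ?e" ?c 0] by (simp add: T_intros)
  moreover have "\<eta> p (\<lambda>f. 0) = 0"
    using eta_comb[of ?e p ?e 0 0] by (simp add: T_intros)
  ultimately have "?c = 0" using pp by simp
  then show ?thesis using e by simp
qed

text \<open>Compatibility of g and \<phi> with \<xi> in the second slot: the left side vanishes by
  \<open>phi_xi\<close>.\<close>

lemma eta_eq: "u \<in> T p \<Longrightarrow> \<eta> p u = g p u (\<xi> p)"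
  using g_phi_phi[of u p "\<xi> p"] g_zero[of "\<phi> p u" p "\<phi> p u"] g_sym[of "\<phi> p u" p "\<lambda>f. 0"]
  by (simp add: phi_xi eta_xi T_intros)

text \<open>Compute the cube of \<phi> at u in two ways. Squaring first gives -\<phi> u; squaring
  last gives the additional term \<eta> (\<phi> u) \<xi>, which must vanish.\<close>

lemma eta_phi: "u \<in> T p \<Longrightarrow> \<eta> p (\<phi> p u) = 0"
proof -
  assume u: "u \<in> T p"
  have "\<phi> p (\<phi> p (\<phi> p u)) = (\<lambda>f. - \<phi> p u f)"
    using phi_phi[OF u] u by (simp add: phi_diff phi_scale phi_xi T_intros)
  then have "\<eta> p (\<phi> p u) * \<xi> p f = 0" for f
    using phi_phi[OF T_phi[OF u]] by (auto dest: fun_cong[of _ _ f])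
  then have "(\<lambda>f. \<eta> p (\<phi> p u) * \<xi> p f + 0 * \<xi> p f) = (\<lambda>f. 0 * \<xi> p f + 0 * \<xi> p f)"
    by auto
  then have "\<eta> p (\<lambda>f. \<eta> p (\<phi> p u) * \<xi> p f + 0 * \<xi> p f) = \<eta> p (\<lambda>f. 0 * \<xi> p f + 0 * \<xi> p f)"
    by (rule arg_cong)
  then show ?thesis
    unfolding eta_comb[OF T_xi T_xi] by (simp add: eta_xi)
qed

text \<open>Apply compatibility to u and \<phi> v, then expand \<phi> (\<phi> v); its
  \<xi>-component is orthogonal to \<phi> u.\<close>

lemma phi_skew:
  assumes "u \<in> T p" "v \<in> T p"
  shows "g p (\<phi> p u) v = - g p u (\<phi> p v)"
proof -
  have "g p (\<xi> p) (\<phi> p u) = 0"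
    using eta_phi[OF assms(1)] eta_eq[OF T_phi[OF assms(1)]] g_sym[OF T_xi T_phi[OF assms(1)]] by simp
  then have "g p (\<phi> p (\<phi> p v)) (\<phi> p u) = - g p v (\<phi> p u)"
    using assms by (simp add: phi_phi T_intros g_diff g_scale)
  moreover have "g p (\<phi> p u) (\<phi> p (\<phi> p v)) = g p u (\<phi> p v)"
    using assms by (simp add: g_phi_phi eta_phi T_phi)
  ultimately show ?thesis
    using assms g_sym[of "\<phi> p u" p "\<phi> p (\<phi> p v)"] g_sym[of "\<phi> p u" p v] by (simp add: T_phi)
qed

section \<open>The covariant derivative of \<xi>\<close>

lemma metric_compatible: "X \<in> VF \<Longrightarrow> Y \<in> VF \<Longrightarrow> Z \<in> VF \<Longrightarrow>
    X p (\<lambda>q. g q (Y q) (Z q)) = g p (D X Y p) (Z p) + g p (Y p) (D X Z p)"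
  using levi_civita by (simp add: levi_civita_connection_def)

lemma torsion_free:
  assumes "X \<in> VF" "Y \<in> VF"
  shows "lie_bracket X Y p = (\<lambda>f. D X Y p f - D Y X p f)"
proof -
  have "(\<lambda>p f. D X Y p f - D Y X p f) = lie_bracket X Y"
    using levi_civita assms by (simp add: levi_civita_connection_def)
  then show ?thesis by (metis (no_types))
qed

lemma D_comb: "X \<in> VF \<Longrightarrow> Y \<in> VF \<Longrightarrow> Z \<in> VF \<Longrightarrow>
    D X (\<lambda>p f. a * Y p f + b * Z p f) = (\<lambda>p f. a * D X Y p f + b * D X Z p f)"
  using levi_civita by (simp add: levi_civita_connection_def affine_connection_def)

lemma D_Leibniz: "X \<in> VF \<Longrightarrow> Y \<in> VF \<Longrightarrow> smooth_fun \<A> h \<Longrightarrow>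
    D X (\<lambda>p f. h p * Y p f) = (\<lambda>p f. X p h * Y p f + h p * D X Y p f)"
  using levi_civita by (simp add: levi_civita_connection_def affine_connection_def)

lemma D_zero: "X \<in> VF \<Longrightarrow> D X (\<lambda>p f. 0) = (\<lambda>p f. 0)"
  using D_comb[of X X X 0 0] by simp

text \<open>Differentiate the constant g (\<xi>, \<xi>) = 1.\<close>

lemma eta_D_xi: "X \<in> VF \<Longrightarrow> \<eta> p (D X \<xi> p) = 0"
proof -
  assume X: "X \<in> VF"
  have "X p (\<lambda>q. g q (\<xi> q) (\<xi> q)) = 0"
    using tangent_vector_const[OF T_field[OF X], of p 1] eta_eq[OF T_xi] by (simp add: eta_xi)
  then show ?thesis
    using metric_compatible[OF X xi_field xi_field, of p] X
    by (simp add: eta_eq g_sym[of "\<xi> p"] T_intros)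
qed

text \<open>Because \<phi> \<xi> = 0, the derivative of \<phi> along X sends \<xi> to
  \<open>- \<phi> p (D X \<xi> p)\<close>. The last two summands are \<phi> (\<phi> X).\<close>

lemma nearly_sasakian_xi:
  assumes X: "X \<in> VF"
  shows "D \<xi> (\<lambda>q. \<phi> q (X q)) p
    = (\<lambda>f. \<phi> p (D \<xi> X p) f + \<phi> p (D X \<xi> p) f + \<eta> p (X p) * \<xi> p f - X p f)"
proof
  fix f
  have "cov_deriv_endo D \<phi> X \<xi> p f + cov_deriv_endo D \<phi> \<xi> X p f =
          2 * g p (X p) (\<xi> p) * \<xi> p f - \<eta> p (X p) * \<xi> p f - \<eta> p (\<xi> p) * X p f"
    using nearly_sasakian X xi_field by (simp add: nearly_sasakian_def)
  then show "D \<xi> (\<lambda>q. \<phi> q (X q)) p f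
      = \<phi> p (D \<xi> X p) f + \<phi> p (D X \<xi> p) f + \<eta> p (X p) * \<xi> p f - X p f"
    by (simp add: cov_deriv_endo_def phi_xi D_zero[OF X] eta_xi eta_eq[OF T_field[OF X], symmetric] algebra_simps)
qed

text \<open>For X = \<xi> the identity collapses to twice \<open>\<phi> p (D \<xi> \<xi> p)\<close>
  being 0. The kernel of \<phi> is spanned by \<xi>, and \<open>eta_D_xi\<close> excludes a
  \<xi>-component.\<close>

lemma D_xi_xi: "D \<xi> \<xi> p = (\<lambda>f. 0)"
proof -
  have "\<phi> p (D \<xi> \<xi> p) f = 0" for f
    using nearly_sasakian_xi[OF xi_field, of p] by (simp add: phi_xi D_zero[OF xi_field] eta_xi fun_eq_iff)
  then have "\<phi> p (\<phi> p (D \<xi> \<xi> p)) = (\<lambda>f. 0)"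
    using phi_zero[OF T_xi] by (metis ext)
  then show ?thesis
    using phi_phi[OF T_D[OF xi_field xi_field], of p] by (simp add: eta_D_xi[OF xi_field] fun_eq_iff)
qed

section \<open>The Killing property of \<xi>\<close>

text \<open>\<open>\<nabla>\<^sub>\<xi> \<phi>\<close> is skew-symmetric because \<open>\<phi>\<close> is.\<close>

lemma D_xi_phi_skew:
  assumes X: "X \<in> VF" and Y: "Y \<in> VF"
  shows "g p (D X \<xi> p) (\<phi> p (Y p)) + g p (D Y \<xi> p) (\<phi> p (X p)) = - 2 * g p (\<phi> p (X p)) (\<phi> p (Y p))"
proof -
  have smooth: "smooth_fun \<A> (\<lambda>q. g q (X q) (\<phi> q (Y q)))"
    using metric X VF_phi[OF Y] by (simp add: riemannian_metric_def)
  \<comment> \<open>Differentiate g (\<phi> X, Y) = -g (X, \<phi> Y) along \<xi>, an identity of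
    functions on the manifold.\<close>
  have "\<xi> p (\<lambda>q. g q (\<phi> q (X q)) (Y q)) = \<xi> p (\<lambda>q. - g q (X q) (\<phi> q (Y q)))"
    by (simp add: phi_skew T_field X Y)
  also have "\<dots> = - \<xi> p (\<lambda>q. g q (X q) (\<phi> q (Y q)))"
    by (rule tangent_vector_uminus[OF T_xi smooth])
  finally have "g p (D \<xi> (\<lambda>q. \<phi> q (X q)) p) (Y p) + g p (\<phi> p (X p)) (D \<xi> Y p)
      = - (g p (D \<xi> X p) (\<phi> p (Y p)) + g p (X p) (D \<xi> (\<lambda>q. \<phi> q (Y q)) p))"
    using metric_compatible[OF xi_field VF_phi[OF X] Y] metric_compatible[OF xi_field X VF_phi[OF Y]]
    by simp
  moreover have "g p (D \<xi> (\<lambda>q. \<phi> q (X q)) p) (Y p)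
      = - g p (D \<xi> X p) (\<phi> p (Y p)) - g p (D X \<xi> p) (\<phi> p (Y p)) + \<eta> p (X p) * \<eta> p (Y p) - g p (X p) (Y p)"
    using X Y by (simp add: nearly_sasakian_xi T_intros g_add g_diff g_scale phi_skew eta_eq[of "Y p"] g_sym[of "Y p"])
  moreover have "g p (D \<xi> (\<lambda>q. \<phi> q (Y q)) p) (X p)
      = - g p (D \<xi> Y p) (\<phi> p (X p)) - g p (D Y \<xi> p) (\<phi> p (X p)) + \<eta> p (Y p) * \<eta> p (X p) - g p (Y p) (X p)"
    using X Y by (simp add: nearly_sasakian_xi T_intros g_add g_diff g_scale phi_skew eta_eq[of "X p"] g_sym[of "X p"])
  \<comment> \<open>The derivatives of X and Y along \<xi> cancel in pairs. Each of the two
    expansions leaves one copy of -g (\<phi> X, \<phi> Y), whence the constant -2.\<close>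
  ultimately show ?thesis
    using g_sym[of "X p" p "D \<xi> (\<lambda>q. \<phi> q (Y q)) p"] g_sym[of "X p" p "Y p"] g_sym[of "\<phi> p (X p)" p "D \<xi> Y p"]
    by (simp add: g_phi_phi T_intros X Y)
qed

text \<open>\<open>\<nabla>\<^sub>\<xi> (\<phi>\<^sup>2) = 0\<close>, that is, \<open>\<nabla>\<^sub>\<xi> \<phi>\<close> anticommutes with \<open>\<phi>\<close>.\<close>

lemma phi_D_phi_xi:
  assumes X: "X \<in> VF"
  shows "\<phi> p (D (\<lambda>q. \<phi> q (X q)) \<xi> p) = (\<lambda>f. D X \<xi> p f + 2 * \<phi> p (X p) f)"
proof
  fix f
  let ?h = "\<lambda>q. \<eta> q (X q)"
  have h: "smooth_fun \<A> ?h" using one_form X by (simp add: one_form_def)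
  have hxi: "(\<lambda>q f. ?h q * \<xi> q f) \<in> VF"
    using vector_fields_comb[OF xi_field xi_field h smooth_fun_const[of 0]] by simp
  \<comment> \<open>Differentiating \<eta> (X) = g (X, \<xi>) produces no second term because of
    \<open>D_xi_xi\<close>.\<close>
  have "\<xi> p ?h = \<eta> p (D \<xi> X p)"
    using metric_compatible[OF xi_field X xi_field, of p] g_zero[OF T_xi T_field[OF X], of p]
    by (simp add: eta_eq T_intros X D_xi_xi g_sym[of "X p"])
  then have "D \<xi> (\<lambda>q f. - 1 * X q f + 1 * (?h q * \<xi> q f)) p f = - D \<xi> X p f + \<eta> p (D \<xi> X p) * \<xi> p f"
    unfolding D_comb[OF xi_field X hxi] D_Leibniz[OF xi_field xi_field h] by (simp add: D_xi_xi)
  moreover have "(\<lambda>q f. - 1 * X q f + 1 * (?h q * \<xi> q f)) = (\<lambda>q. \<phi> q (\<phi> q (X q)))"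
    using phi_phi[OF T_field[OF X]] by simp
  ultimately have "D \<xi> (\<lambda>q. \<phi> q (\<phi> q (X q))) p f = - D \<xi> X p f + \<eta> p (D \<xi> X p) * \<xi> p f"
    by simp
  \<comment> \<open>The same derivative by the nearly Sasakian identity, for \<phi> X here and for X
    in the next step. Each use contributes one -\<phi> X, hence the 2 in the claim.\<close>
  moreover have "D \<xi> (\<lambda>q. \<phi> q (\<phi> q (X q))) p f = \<phi> p (D \<xi> (\<lambda>q. \<phi> q (X q)) p) f
      + \<phi> p (D (\<lambda>q. \<phi> q (X q)) \<xi> p) f - \<phi> p (X p) f"
    using nearly_sasakian_xi[OF VF_phi[OF X], of p] eta_phi[OF T_field[OF X], of p] by simp
  moreover have "\<phi> p (D \<xi> (\<lambda>q. \<phi> q (X q)) p) f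
      = - D \<xi> X p f + \<eta> p (D \<xi> X p) * \<xi> p f - D X \<xi> p f - \<phi> p (X p) f"
    using X by (simp add: nearly_sasakian_xi T_intros phi_add phi_diff phi_scale phi_xi phi_phi eta_D_xi)
  ultimately show "\<phi> p (D (\<lambda>q. \<phi> q (X q)) \<xi> p) f = D X \<xi> p f + 2 * \<phi> p (X p) f"
    by simp
qed

text \<open>Write A X for \<open>D X \<xi>\<close> and put \<phi> X for X in
  \<open>D_xi_phi_skew\<close>. The first term becomes -g (A X, Y) - 2 g (\<phi> X, Y) by
  \<open>phi_D_phi_xi\<close>, the second -g (A Y, X) because A Y is orthogonal to \<xi>, and the
  right side -2 g (\<phi> X, Y), which cancels.\<close>

lemma xi_Killing:
  assumes X: "X \<in> VF" and Y: "Y \<in> VF"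
  shows "g p (D X \<xi> p) (Y p) = - g p (D Y \<xi> p) (X p)"
proof -
  let ?PX = "\<lambda>q. \<phi> q (X q)"
  have "g p (\<phi> p (D ?PX \<xi> p)) (Y p) = g p (D X \<xi> p) (Y p) + 2 * g p (\<phi> p (X p)) (Y p)"
    using X Y by (simp add: phi_D_phi_xi T_intros g_add g_scale)
  moreover have "g p (\<phi> p (D ?PX \<xi> p)) (Y p) = - g p (D ?PX \<xi> p) (\<phi> p (Y p))"
    using X Y by (simp add: phi_skew T_intros)
  moreover have "g p (D ?PX \<xi> p) (\<phi> p (Y p)) + g p (D Y \<xi> p) (\<phi> p (\<phi> p (X p)))
      = - 2 * g p (\<phi> p (\<phi> p (X p))) (\<phi> p (Y p))"
    using D_xi_phi_skew[OF VF_phi[OF X] Y] .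
  moreover have "g p (\<phi> p (\<phi> p (X p))) (\<phi> p (Y p)) = g p (\<phi> p (X p)) (Y p)"
    using X Y by (simp add: g_phi_phi[OF T_phi] T_intros eta_phi)
  moreover have "g p (D Y \<xi> p) (\<phi> p (\<phi> p (X p))) = - g p (D Y \<xi> p) (X p)"
    using g_sym[of "D Y \<xi> p" p "\<phi> p (\<phi> p (X p))"] X Y g_sym[of "X p" p "D Y \<xi> p"] eta_D_xi[OF Y, of p]
      eta_eq[of "D Y \<xi> p" p] g_sym[of "\<xi> p" p "D Y \<xi> p"]
    by (simp add: phi_phi T_intros g_diff g_scale)
  ultimately show ?thesis by simp
qed

text \<open>With \<eta> = g (-, \<xi>), vanishing torsion removes the derivatives of the two fields.
  What remains is g (A X, Y) - g (A Y, X) with A X = \<open>D X \<xi>\<close>, and the Killing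
  property doubles the first term.\<close>

lemma ext_deriv_eta:
  assumes "X 0 \<in> VF" "X 1 \<in> VF"
  shows "ext_deriv \<eta> X p = 2 * g p (D (X 0) \<xi> p) (X 1 p)"
proof -
  have *: "Y p (\<lambda>q. \<eta> q (Z q)) = g p (D Y Z p) (\<xi> p) + g p (D Y \<xi> p) (Z p)" if "Y \<in> VF" "Z \<in> VF" for Y Z
    using metric_compatible[OF that xi_field, of p] that
    by (simp add: eta_eq T_intros g_sym[of "Z p"])
  show ?thesis
    using assms xi_Killing[OF assms, of p] *[OF assms] *[OF assms(2,1)]
      eta_eq[of "lie_bracket (X 0) (X 1) p" p]
    by (simp add: ext_deriv_def torsion_free T_intros g_diff)
qed

text \<open>The diagonal case of \<open>D_xi_phi_skew\<close>. On the kernel of \<eta> the value is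
  -2 g (X, X), which yields nondegeneracy there.\<close>

lemma ext_deriv_eta_phi:
  assumes "X \<in> VF"
  shows "2 * g p (D X \<xi> p) (\<phi> p (X p)) = - 2 * (g p (X p) (X p) - (\<eta> p (X p))\<^sup>2)"
  using D_xi_phi_skew[OF assms assms, of p] g_phi_phi[of "X p" p "X p"] assms
  by (simp add: T_intros power2_eq_square)

end


section \<open>Symplectic frames and wedge powers\<close>

text \<open>Gram matrix of a symplectic basis with partners at indices 2i+1 and 2i+2. Index 0 is
  reserved for \<xi> and pairs to 0 with everything.\<close>

definition std_symplectic :: "nat \<Rightarrow> nat \<Rightarrow> real" where
  "std_symplectic i j =
     (if odd i \<and> j = Suc i then 1 else if even i \<and> i = Suc j then - 1 else 0)"

lemma linear_functional_inner:
  fixes L :: "'v::euclidean_space \<Rightarrow> real"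
  assumes "linear L"
  shows "\<exists>z. \<forall>v. L v = z \<bullet> v"
  by (metis adjoint_works[OF assms, of _ 1] inner_commute inner_real_def mult.right_neutral)

text \<open>Fewer equations than unknowns: represent the functionals by vectors and take a vector
  orthogonal to their span.\<close>

lemma ex_common_zero:
  fixes L :: "'i \<Rightarrow> 'v::euclidean_space \<Rightarrow> real"
  assumes "finite I" "card I < DIM('v)" "\<And>i. i \<in> I \<Longrightarrow> linear (L i)"
  shows "\<exists>v. v \<noteq> 0 \<and> (\<forall>i\<in>I. L i v = 0)"
proof -
  have "\<forall>i\<in>I. \<exists>z. \<forall>v. L i v = z \<bullet> v"
    using linear_functional_inner assms(3) by blast
  then obtain z where z: "\<forall>i\<in>I. \<forall>v. L i v = z i \<bullet> v"
    by (auto simp: bchoice_iff)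
  have "dim (z ` I) \<le> card (z ` I)"
    by (rule dim_le_card) (use assms(1) in \<open>auto intro: span_base\<close>)
  also have "\<dots> < DIM('v)"
    using card_image_le[OF assms(1), of z] assms(2) by linarith
  finally obtain v where v: "v \<noteq> 0" "\<And>y. y \<in> span (z ` I) \<Longrightarrow> orthogonal v y"
    using orthogonal_to_subspace_exists by blast
  then have "\<forall>i\<in>I. L i v = 0"
    using z by (metis imageI span_base orthogonal_def inner_commute)
  then show ?thesis using v(1) by blast
qed

text \<open>Symplectic Gram-Schmidt inside the kernel of \<open>E\<close>, one pair at a time;
  \<open>e\<close> sits at index 0 and lies in the radical of \<open>B\<close>.\<close>

lemma ex_symplectic_frame:
  fixes B :: "'v::euclidean_space \<Rightarrow> 'v \<Rightarrow> real" and E :: "'v \<Rightarrow> real"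
  assumes dim: "DIM('v) = 2 * n + 1"
    and B: "bilinear B" and alt: "\<And>v w. B v w = - B w v" and E: "linear E"
    and e: "E e = 1" "\<And>w. B e w = 0"
    and nondeg: "\<And>v. v \<noteq> 0 \<Longrightarrow> E v = 0 \<Longrightarrow> \<exists>w. B v w \<noteq> 0"
  shows "\<exists>b. \<forall>i\<le>2 * n. E (b i) = (if i = 0 then 1 else 0) \<and> (\<forall>j\<le>2 * n. B (b i) (b j) = std_symplectic i j)"
proof -
  have lin: "linear (B v)" "linear (\<lambda>v. B v w)" for v w
    using B by (auto simp: bilinear_def)
  note B_simps = linear_add[OF lin(1)] linear_diff[OF lin(1)] linear_scale[OF lin(1)] linear_sum[OF lin(1)]
  note E_simps = linear_add[OF E] linear_diff[OF E] linear_scale[OF E] linear_sum[OF E]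
  have Be: "B w e = 0" for w using alt[of w e] e(2) by simp
  have "\<exists>b. b 0 = e \<and> (\<forall>i\<in>{1..2 * k}. E (b i) = 0 \<and> (\<forall>j\<in>{1..2 * k}. B (b i) (b j) = std_symplectic i j))"
    if "k \<le> n" for k
    using that
  proof (induction k)
    case 0
    show ?case by auto
  next
    case (Suc k)
    then obtain b where b0: "b 0 = e" and Eb: "\<And>i. i \<in> {1..2 * k} \<Longrightarrow> E (b i) = 0"
      and Bb: "\<And>i j. i \<in> {1..2 * k} \<Longrightarrow> j \<in> {1..2 * k} \<Longrightarrow> B (b i) (b j) = std_symplectic i j"
      using Suc_leD by blast
    define L where "L i = (if i = 0 then E else B (b i))" for i
    have "\<exists>v. v \<noteq> 0 \<and> (\<forall>i\<in>{..2 * k}. L i v = 0)"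
      by (rule ex_common_zero) (use Suc.prems dim E lin in \<open>auto simp: L_def\<close>)
    then obtain v where v: "v \<noteq> 0" "\<And>i. i \<le> 2 * k \<Longrightarrow> L i v = 0" by auto
    have Ev: "E v = 0" using v(2)[of 0] by (simp add: L_def)
    have Bv: "B (b i) v = 0" if "i \<in> {1..2 * k}" for i
      using v(2)[of i] that by (auto simp: L_def)
    obtain w0 where w0: "B v w0 \<noteq> 0" using nondeg[OF v(1) Ev] by blast
    \<comment> \<open>Moves the partner into the kernel of \<open>E\<close>; values of
      \<open>B\<close> do not change since \<open>e\<close> is in its radical.\<close>
    define w1 where "w1 = w0 - E w0 *\<^sub>R e"
    \<comment> \<open>Removes the component in the span of the earlier pairs. As \<open>v\<close> is
      \<open>B\<close>-orthogonal to that span, \<open>B v\<close> keeps its nonzero value.\<close>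
    define w2 where "w2 = w1 - (\<Sum>l<k. B (b (2 * l + 1)) w1 *\<^sub>R b (2 * l + 2) - B (b (2 * l + 2)) w1 *\<^sub>R b (2 * l + 1))"
    have Ew1: "E w1 = 0" by (simp add: w1_def E_simps e(1))
    have Ew2: "E w2 = 0" by (simp add: w2_def E_simps Ew1 Eb)
    have "B v (b i) = 0" if "i \<in> {1..2 * k}" for i
      using Bv[OF that] alt[of v "b i"] by simp
    then have Bvw2: "B v w2 = B v w0" by (simp add: w2_def w1_def B_simps Be)
    have Bw2: "B (b j) w2 = 0" if j: "j \<in> {1..2 * k}" for j
    proof -
      have "B (b j) w2 = B (b j) w1 - (\<Sum>l<k. B (b (2 * l + 1)) w1 * std_symplectic j (2 * l + 2)
          - B (b (2 * l + 2)) w1 * std_symplectic j (2 * l + 1))"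
        unfolding w2_def B_simps by (intro arg_cong2[of _ _ _ _ minus] refl sum.cong) (use j in \<open>simp_all add: Bb\<close>)
      \<comment> \<open>Only the pair containing \<open>j\<close> contributes. For even
        \<open>j\<close> the minus sign in the sum meets the entry -1 of the Gram matrix.\<close>
      also have "(\<Sum>l<k. B (b (2 * l + 1)) w1 * std_symplectic j (2 * l + 2)
          - B (b (2 * l + 2)) w1 * std_symplectic j (2 * l + 1)) = (\<Sum>l<k. if l = (j - 1) div 2 then B (b j) w1 else 0)"
      proof (intro sum.cong refl)
        fix l
        show "B (b (2 * l + 1)) w1 * std_symplectic j (2 * l + 2)
          - B (b (2 * l + 2)) w1 * std_symplectic j (2 * l + 1) = (if l = (j - 1) div 2 then B (b j) w1 else 0)"
        proof (cases "even j")
          case True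
          then have "j = 2 * (j div 2 - 1) + 2" using j by (auto elim!: evenE)
          then obtain m where "j = 2 * m + 2" ..
          then show ?thesis by (auto simp: std_symplectic_def)
        next
          case False
          then obtain m where "j = 2 * m + 1" by (metis oddE)
          then show ?thesis by (auto simp: std_symplectic_def)
        qed
      qed
      also have "\<dots> = B (b j) w1"
      proof -
        have "(j - 1) div 2 < k" using j by auto
        then show ?thesis by (simp add: sum.delta)
      qed
      finally show ?thesis by simp
    qed
    define w where "w = (1 / B v w0) *\<^sub>R w2"
    have w: "E w = 0" "B v w = 1" "\<And>i. i \<in> {1..2 * k} \<Longrightarrow> B (b i) w = 0"
      using w0 by (simp_all add: w_def E_simps B_simps Ew2 Bvw2 Bw2)
    have sym: "B v (b i) = 0" "B w (b i) = 0" if "i \<in> {1..2 * k}" for i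
      using Bv[OF that] w(3)[OF that] alt[of _ "b i"] by auto
    have self: "B v v = 0" "B w w = 0" "B w v = - 1"
      using alt[of v v] alt[of w w] alt[of w v] w(2) by auto
    define b' where "b' i = (if i = 2 * k + 1 then v else if i = 2 * k + 2 then w else b i)" for i
    have cases: "i \<in> {1..2 * k} \<or> i = 2 * k + 1 \<or> i = 2 * k + 2" if "i \<in> {1..2 * Suc k}" for i
      using that by auto
    have "E (b' i) = 0" if "i \<in> {1..2 * Suc k}" for i
      using cases[OF that] by (auto simp: b'_def Ev w Eb)
    moreover have "B (b' i) (b' j) = std_symplectic i j" if "i \<in> {1..2 * Suc k}" "j \<in> {1..2 * Suc k}" for i j
    proof -
      have old: "b' l = b l" "l \<noteq> 2 * k + 1" "l \<noteq> 2 * k + 2" if "l \<in> {1..2 * k}" for l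
        using that by (auto simp: b'_def)
      have new: "b' (2 * k + 1) = v" "b' (2 * k + 2) = w" by (auto simp: b'_def)
      have std: "std_symplectic l (2 * k + 1) = 0" "std_symplectic l (2 * k + 2) = 0"
        "std_symplectic (2 * k + 1) l = 0" "std_symplectic (2 * k + 2) l = 0" if "l \<in> {1..2 * k}" for l
        using that by (auto simp: std_symplectic_def)
      have std': "std_symplectic (2 * k + 1) (2 * k + 2) = 1" "std_symplectic (2 * k + 2) (2 * k + 1) = - 1"
        "std_symplectic (2 * k + 1) (2 * k + 1) = 0" "std_symplectic (2 * k + 2) (2 * k + 2) = 0"
        by (auto simp: std_symplectic_def)
      show ?thesis
        using cases[OF that(1)] cases[OF that(2)]
        by (elim disjE) (simp_all only: old new std std' sym self Bb Bv w)
    qed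
    moreover have "b' 0 = e" by (simp add: b'_def b0)
    ultimately show ?case by blast
  qed
  from this[OF order_refl] obtain b where b: "b 0 = e" "\<forall>i\<in>{1..2 * n}. E (b i) = 0"
    "\<forall>i\<in>{1..2 * n}. \<forall>j\<in>{1..2 * n}. B (b i) (b j) = std_symplectic i j"
    by blast
  have "B (b i) (b j) = std_symplectic i j" if "i \<le> 2 * n" "j \<le> 2 * n" for i j
  proof (cases "i = 0 \<or> j = 0")
    case True
    then have "std_symplectic i j = 0" by (auto simp: std_symplectic_def)
    then show ?thesis using True b(1) e(2) Be by auto
  qed (use that b(3) in auto)
  moreover have "E (b i) = (if i = 0 then 1 else 0)" if "i \<le> 2 * n" for i
    using that b(1,2) e(1) by (cases i) auto
  ultimately show ?thesis by blast
qed

section \<open>Wedge products as sums over permutations\<close>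

lemma perm_sum_wedge:
  fixes \<alpha> \<beta> :: "'a dform"
  assumes \<alpha>: "\<And>X Y. (\<And>i. i < k \<Longrightarrow> X i = Y i) \<Longrightarrow> \<alpha> X p = \<alpha> Y p"
    and \<beta>: "\<And>X. \<beta> X p = c * (\<Sum>\<tau> | \<tau> permutes {..<l}. of_int (sign \<tau>) * F (\<lambda>i. X (\<tau> i)))"
  shows "wedge k l \<alpha> \<beta> X p = c / fact k *
    (\<Sum>\<sigma> | \<sigma> permutes {..<k + l}. of_int (sign \<sigma>) * (\<alpha> (\<lambda>i. X (\<sigma> i)) p * F (\<lambda>i. X (\<sigma> (k + i)))))"
proof -
  let ?P = "{\<sigma>. \<sigma> permutes {..<k + l}}" and ?Q = "{\<tau>. \<tau> permutes {..<l}}"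
  let ?t = "\<lambda>\<sigma>. of_int (sign \<sigma>) * (\<alpha> (\<lambda>i. X (\<sigma> i)) p * F (\<lambda>i. X (\<sigma> (k + i))))"
  \<comment> \<open>Inserting the sum for \<beta> gives a double sum over \<sigma> and \<tau>. Let
    \<rho> be \<tau> moved to the last l slots: it has the same sign and fixes the slots read by
    \<alpha>. Reindexing \<sigma> by \<sigma> \<circ> \<rho> shows that every \<tau> contributes
    equally, so the factor \<open>fact l\<close> in the denominator cancels.\<close>
  have shift: "(\<Sum>\<sigma>\<in>?P. of_int (sign \<sigma>) * of_int (sign \<tau>) * (\<alpha> (\<lambda>i. X (\<sigma> i)) p * F (\<lambda>i. X (\<sigma> (k + \<tau> i)))))
      = sum ?t ?P" if "\<tau> \<in> ?Q" for \<tau>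
  proof -
    define \<rho> where "\<rho> = map_permutation {..<l} ((+) k) \<tau>"
    have \<tau>: "\<tau> permutes {..<l}" using that by simp
    have \<rho>P: "\<rho> permutes {k..<k + l}"
      unfolding \<rho>_def by (rule map_permutation_permutes[OF _ \<tau>])
        (auto simp: bij_betw_def image_add_atLeastLessThan lessThan_atLeast0)
    then have \<rho>: "\<rho> permutes {..<k + l}"
      by (rule permutes_subset) auto
    have \<rho>_sign: "sign \<rho> = sign \<tau>"
      unfolding \<rho>_def by (rule sign_map_permutation[OF _ \<tau>]) auto
    have \<rho>_low: "\<rho> i = i" if "i < k" for i
      using permutes_not_in[OF \<rho>P] that by auto
    have \<rho>_high: "\<rho> (k + i) = k + \<tau> i" for i
    proof (cases "i < l")
      case True
      then show ?thesis unfolding \<rho>_def by (intro map_permutation_apply) auto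
    next
      case False
      then show ?thesis using permutes_not_in[OF \<rho>P] permutes_not_in[OF \<tau>] by auto
    qed
    have "sum ?t ?P = (\<Sum>\<sigma>\<in>?P. ?t (\<sigma> \<circ> \<rho>))"
      by (rule sum_permutations_compose_right[OF \<rho>])
    also have "\<dots> = (\<Sum>\<sigma>\<in>?P. of_int (sign \<sigma>) * of_int (sign \<tau>) * (\<alpha> (\<lambda>i. X (\<sigma> i)) p * F (\<lambda>i. X (\<sigma> (k + \<tau> i)))))"
    proof (intro sum.cong refl)
      fix \<sigma> assume "\<sigma> \<in> ?P"
      then have "sign (\<sigma> \<circ> \<rho>) = sign \<sigma> * sign \<tau>"
        using \<rho> \<rho>_sign by (subst sign_compose) (auto simp: permutation_permutes)
      moreover have "\<alpha> (\<lambda>i. X ((\<sigma> \<circ> \<rho>) i)) p = \<alpha> (\<lambda>i. X (\<sigma> i)) p"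
        by (rule \<alpha>) (simp add: \<rho>_low)
      ultimately show "?t (\<sigma> \<circ> \<rho>) =
          of_int (sign \<sigma>) * of_int (sign \<tau>) * (\<alpha> (\<lambda>i. X (\<sigma> i)) p * F (\<lambda>i. X (\<sigma> (k + \<tau> i))))"
        by (simp add: \<rho>_high)
    qed
    finally show ?thesis by simp
  qed
  have "wedge k l \<alpha> \<beta> X p = (\<Sum>\<sigma>\<in>?P. \<Sum>\<tau>\<in>?Q. c * (of_int (sign \<sigma>) * of_int (sign \<tau>) *
      (\<alpha> (\<lambda>i. X (\<sigma> i)) p * F (\<lambda>i. X (\<sigma> (k + \<tau> i)))))) / (fact k * fact l)"
    by (simp add: wedge_def \<beta> sum_distrib_left mult_ac)
  also have "\<dots> = c * (\<Sum>\<tau>\<in>?Q. \<Sum>\<sigma>\<in>?P. of_int (sign \<sigma>) * of_int (sign \<tau>) *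
      (\<alpha> (\<lambda>i. X (\<sigma> i)) p * F (\<lambda>i. X (\<sigma> (k + \<tau> i))))) / (fact k * fact l)"
    by (subst sum.swap) (simp add: sum_distrib_left)
  also have "\<dots> = c * (fact l * sum ?t ?P) / (fact k * fact l)"
    by (simp add: shift card_permutations)
  finally show ?thesis by simp
qed

text \<open>Each wedge factor leaves one \<open>1 / fact 2\<close>, since
  \<open>perm_sum_wedge\<close> cancels the other factorial.\<close>

lemma perm_sum_wedge_power2:
  assumes \<omega>: "\<And>X Y. (\<And>i. i < 2 \<Longrightarrow> X i = Y i) \<Longrightarrow> \<omega> X p = \<omega> Y p"
  shows "wedge_power2 \<omega> n X p = 1 / 2 ^ n *
    (\<Sum>\<sigma> | \<sigma> permutes {..<2 * n}. of_int (sign \<sigma>) * (\<Prod>i<n. \<omega> (\<lambda>j. X (\<sigma> (2 * i + j))) p))"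
proof (induction n arbitrary: X)
  case 0
  then show ?case by simp
next
  case (Suc n)
  have "wedge 2 (2 * n) \<omega> (wedge_power2 \<omega> n) X p = 1 / 2 ^ n / fact 2 *
      (\<Sum>\<sigma> | \<sigma> permutes {..<2 + 2 * n}. of_int (sign \<sigma>) *
        (\<omega> (\<lambda>i. X (\<sigma> i)) p * (\<Prod>i<n. \<omega> (\<lambda>j. X (\<sigma> (2 + (2 * i + j)))) p)))"
    by (rule perm_sum_wedge[where F = "\<lambda>Y. \<Prod>i<n. \<omega> (\<lambda>j. Y (2 * i + j)) p"]) (fact \<omega>, rule Suc.IH)
  then show ?case
    by (simp add: prod.lessThan_Suc_shift del: prod.lessThan_Suc)
qed

text \<open>A permutation that maps the pairs \<open>{2 i + 1, 2 i + 2}\<close> to such pairs has the sign of the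
  number of pairs that it reverses.\<close>

lemma prod_std_symplectic_eq_sign:
  assumes "\<sigma> permutes {1..2 * n}" "(\<Prod>i<n. std_symplectic (\<sigma> (2 * i + 1)) (\<sigma> (2 * i + 2))) \<noteq> 0"
  shows "(\<Prod>i<n. std_symplectic (\<sigma> (2 * i + 1)) (\<sigma> (2 * i + 2))) = of_int (sign \<sigma>)"
  using assms
proof (induction n arbitrary: \<sigma>)
  case 0
  then show ?case by simp
next
  case (Suc n)
  let ?s = "\<lambda>n \<sigma>. \<Prod>i<n. std_symplectic (\<sigma> (2 * i + 1)) (\<sigma> (2 * i + 2))"
  let ?a = "2 * n + 1" and ?b = "2 * n + 2"
  note perm = permutation_permutes
  have fixing: "?s n \<sigma> = of_int (sign \<sigma>)"
    if \<sigma>: "\<sigma> permutes {1..2 * Suc n}" "\<sigma> ?a = ?a" "\<sigma> ?b = ?b" "?s n \<sigma> \<noteq> 0" for \<sigma>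
  proof (rule Suc.IH)
    show "\<sigma> permutes {1..2 * n}"
    proof (rule permutes_superset[OF \<sigma>(1)])
      fix x assume "x \<in> {1..2 * Suc n} - {1..2 * n}"
      then have "x = ?a \<or> x = ?b" by auto
      then show "\<sigma> x = x" using \<sigma> by auto
    qed
  qed (rule \<sigma>(4))
  have last: "?s (Suc n) \<sigma> = of_int (sign \<sigma>)"
    if \<sigma>: "\<sigma> permutes {1..2 * Suc n}" "\<sigma> ?a = ?a \<and> \<sigma> ?b = ?b \<or> \<sigma> ?a = ?b \<and> \<sigma> ?b = ?a"
      "?s (Suc n) \<sigma> \<noteq> 0" for \<sigma>
    using \<sigma>(2)
  proof
    assume "\<sigma> ?a = ?a \<and> \<sigma> ?b = ?b"
    then show ?thesis using fixing[OF \<sigma>(1)] \<sigma>(3) by (simp add: std_symplectic_def)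
  next
    assume ab: "\<sigma> ?a = ?b \<and> \<sigma> ?b = ?a"
    \<comment> \<open>Undoing the reversal of the last pair changes the sign, and the factor of the
      reversed pair is -1; the earlier factors are untouched.\<close>
    define \<sigma>' where "\<sigma>' = \<sigma> \<circ> Transposition.transpose ?a ?b"
    have t: "Transposition.transpose ?a ?b permutes {1..2 * Suc n}"
      by (rule permutes_swap_id) auto
    have \<sigma>': "\<sigma>' permutes {1..2 * Suc n}"
      unfolding \<sigma>'_def by (rule permutes_compose[OF t \<sigma>(1)])
    have "sign \<sigma>' = - sign \<sigma>"
      unfolding \<sigma>'_def using \<sigma>(1) t by (subst sign_compose) (auto simp: perm sign_swap_id)
    moreover have s: "?s n \<sigma>' = ?s n \<sigma>"
      by (intro prod.cong refl) (simp add: \<sigma>'_def Transposition.transpose_def)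
    moreover have "?s n \<sigma>' = of_int (sign \<sigma>')"
      using \<sigma>(3) s by (intro fixing \<sigma>') (use ab in \<open>auto simp: \<sigma>'_def\<close>)
    ultimately show ?thesis
      using ab by (simp add: std_symplectic_def)
  qed
  have "?a \<in> \<sigma> ` {1..2 * Suc n}"
    using permutes_image[OF Suc.prems(1)] by simp
  then obtain q where q: "q \<in> {1..2 * Suc n}" "\<sigma> q = ?a" by auto
  \<comment> \<open>Pair \<open>i\<close> contains the preimage of 2n+1. Its factor is nonzero and
    2n+1 pairs nontrivially only with 2n+2, so \<sigma> sends this pair to the last one.\<close>
  define i where "i = (q - 1) div 2"
  have i: "i < Suc n" "q = 2 * i + 1 \<or> q = 2 * i + 2"
    using q(1) by (auto simp: i_def)
  have "std_symplectic (\<sigma> (2 * i + 1)) (\<sigma> (2 * i + 2)) \<noteq> 0"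
    using Suc.prems(2) i(1) by (meson finite_lessThan lessThan_iff prod_zero)
  moreover have "std_symplectic ?a x \<noteq> 0 \<Longrightarrow> x = ?b" "std_symplectic x ?a \<noteq> 0 \<Longrightarrow> x = ?b" for x
    by (auto simp: std_symplectic_def split: if_splits)
  ultimately have pair: "\<sigma> (2 * i + 1) = ?a \<and> \<sigma> (2 * i + 2) = ?b \<or> \<sigma> (2 * i + 1) = ?b \<and> \<sigma> (2 * i + 2) = ?a"
    using i(2) q(2) by metis
  show ?case
  proof (cases "i = n")
    case True
    show ?thesis
      by (rule last[OF Suc.prems(1) _ Suc.prems(2)]) (use pair True in simp)
  next
    case False
    \<comment> \<open>Exchanges pair \<open>i\<close> with the last pair. Being two disjoint
      transpositions it is even, and it merely reorders the factors, so \<sigma> \<circ> \<rho>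
      reduces to the case \<open>last\<close>.\<close>
    define \<rho> where "\<rho> = Transposition.transpose (2 * i + 1) ?a \<circ> Transposition.transpose (2 * i + 2) ?b"
    have t: "Transposition.transpose (2 * i + 1) ?a permutes {1..2 * Suc n}" "Transposition.transpose (2 * i + 2) ?b permutes {1..2 * Suc n}"
      using i(1) by (auto intro!: permutes_swap_id)
    have \<rho>: "\<rho> permutes {1..2 * Suc n}"
      unfolding \<rho>_def by (rule permutes_compose[OF t(2,1)])
    have "sign \<rho> = 1"
      unfolding \<rho>_def using t False by (subst sign_compose) (auto simp: perm sign_swap_id)
    then have sign: "sign (\<sigma> \<circ> \<rho>) = sign \<sigma>"
      using Suc.prems(1) \<rho> by (subst sign_compose) (auto simp: perm)
    have \<rho>_pair: "\<rho> (2 * j + 1) = 2 * Transposition.transpose i n j + 1" "\<rho> (2 * j + 2) = 2 * Transposition.transpose i n j + 2" for j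
    proof -
      have "2 * j + 1 \<noteq> 2 * l + 2" "2 * j + 2 \<noteq> 2 * l + 1" for j l :: nat
        by presburger+
      then show "\<rho> (2 * j + 1) = 2 * Transposition.transpose i n j + 1" "\<rho> (2 * j + 2) = 2 * Transposition.transpose i n j + 2"
        unfolding \<rho>_def Transposition.transpose_def o_apply by (simp_all del: One_nat_def add_Suc_right add_2_eq_Suc' Suc_eq_plus1)
    qed
    define f where "f j = std_symplectic (\<sigma> (2 * j + 1)) (\<sigma> (2 * j + 2))" for j
    have "?s (Suc n) (\<sigma> \<circ> \<rho>) = (\<Prod>j<Suc n. f (Transposition.transpose i n j))"
      by (simp only: o_apply \<rho>_pair f_def)
    also have "\<dots> = (\<Prod>j<Suc n. f j)"
      using i(1) by (intro prod.reindex_bij_betw permutes_imp_bij permutes_swap_id) auto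
    finally have s: "?s (Suc n) (\<sigma> \<circ> \<rho>) = ?s (Suc n) \<sigma>"
      unfolding f_def .
    have "?s (Suc n) (\<sigma> \<circ> \<rho>) = of_int (sign (\<sigma> \<circ> \<rho>))"
    proof (rule last)
      show "\<sigma> \<circ> \<rho> permutes {1..2 * Suc n}"
        by (rule permutes_compose[OF \<rho> Suc.prems(1)])
      show "?s (Suc n) (\<sigma> \<circ> \<rho>) \<noteq> 0"
        unfolding s by (rule Suc.prems(2))
    qed (use pair in \<open>simp only: o_apply \<rho>_pair transpose_apply_second\<close>)
    then show ?thesis unfolding s sign .
  qed
qed

text \<open>A nonzero term forces \<sigma> 0 = 0, so \<sigma> restricts to {1..2n}. By
  \<open>prod_std_symplectic_eq_sign\<close> the term is then the square of a sign.\<close>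

lemma wedge_symplectic_frame_pos:
  assumes \<eta>: "\<And>i. i \<le> 2 * n \<Longrightarrow> \<eta> p (X i p) = (if i = 0 then 1 else 0)"
    and \<omega>: "\<And>X Y. (\<And>i. i < 2 \<Longrightarrow> X i = Y i) \<Longrightarrow> \<omega> X p = \<omega> Y p"
    and std: "\<And>Y i j. i \<le> 2 * n \<Longrightarrow> j \<le> 2 * n \<Longrightarrow> Y 0 = X i \<Longrightarrow> Y 1 = X j \<Longrightarrow> \<omega> Y p = std_symplectic i j"
  shows "wedge 1 (2 * n) (form_of_one_form \<eta>) (wedge_power2 \<omega> n) X p > 0"
proof -
  define t where "t \<sigma> = of_int (sign \<sigma>) * (form_of_one_form \<eta> (\<lambda>i. X (\<sigma> i)) p *
      (\<Prod>i<n. \<omega> (\<lambda>j. X (\<sigma> (1 + (2 * i + j)))) p))" for \<sigma>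
  let ?P = "{\<sigma>. \<sigma> permutes {..<1 + 2 * n}}"
  have w: "wedge 1 (2 * n) (form_of_one_form \<eta>) (wedge_power2 \<omega> n) X p = 1 / 2 ^ n / fact 1 * sum t ?P"
    unfolding t_def
    by (rule perm_sum_wedge[where F = "\<lambda>Y. \<Prod>i<n. \<omega> (\<lambda>j. Y (2 * i + j)) p"])
      (simp add: form_of_one_form_def, rule perm_sum_wedge_power2, fact \<omega>)
  have t: "t \<sigma> = of_int (sign \<sigma>) * ((if \<sigma> 0 = 0 then 1 else 0) *
      (\<Prod>i<n. std_symplectic (\<sigma> (2 * i + 1)) (\<sigma> (2 * i + 2))))" if "\<sigma> \<in> ?P" for \<sigma>
  proof -
    have \<sigma>: "\<sigma> i \<le> 2 * n" if "i \<le> 2 * n" for i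
      using permutes_in_image[of \<sigma> "{..<1 + 2 * n}" i] that \<open>\<sigma> \<in> ?P\<close> by auto
    have "\<omega> (\<lambda>j. X (\<sigma> (1 + (2 * i + j)))) p = std_symplectic (\<sigma> (2 * i + 1)) (\<sigma> (2 * i + 2))" if "i < n" for i
      using that by (intro std \<sigma>) auto
    then show ?thesis
      using \<eta>[OF \<sigma>[of 0]] by (simp add: t_def form_of_one_form_def)
  qed
  have "t \<sigma> \<ge> 0" if "\<sigma> \<in> ?P" for \<sigma>
  proof (cases "\<sigma> 0 = 0 \<and> (\<Prod>i<n. std_symplectic (\<sigma> (2 * i + 1)) (\<sigma> (2 * i + 2))) \<noteq> 0")
    case True
    have "\<sigma> permutes {1..2 * n}"
    proof (rule permutes_superset)
      show "\<sigma> permutes {..<1 + 2 * n}" using that by simp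
      fix x assume "x \<in> {..<1 + 2 * n} - {1..2 * n}"
      then have "x = 0" by auto
      then show "\<sigma> x = x" using True by simp
    qed
    then have "t \<sigma> = of_int (sign \<sigma>) * of_int (sign \<sigma>)"
      using True prod_std_symplectic_eq_sign t[OF that] by simp
    then show ?thesis by simp
  next
    case False
    then have "\<sigma> 0 \<noteq> 0 \<or> (\<Prod>i<n. std_symplectic (\<sigma> (2 * i + 1)) (\<sigma> (2 * i + 2))) = 0"
      unfolding de_Morgan_conj not_not .
    then show ?thesis unfolding t[OF that]
      by (elim disjE) (simp_all only: if_False mult_zero_left mult_zero_right order_refl)
  qed
  \<comment> \<open>One strictly positive term makes the sum of nonnegative terms positive.\<close>
  moreover have "t id > 0"
    by (simp add: t[of id] permutes_id std_symplectic_def)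
  moreover have "id \<in> ?P" "finite ?P"
    by (simp_all add: permutes_id finite_permutations)
  ultimately have "sum t ?P > 0"
    by (intro sum_pos2[of _ id]) auto
  then show ?thesis unfolding w by simp
qed

section \<open>From the symplectic frame at a point to the contact condition\<close>

theorem corollary4p11:
  fixes \<A> :: "('a::{t2_space,second_countable_topology}, 'm::finite) chart set"
    and n :: nat
    and D :: "'a vfield \<Rightarrow> 'a vfield \<Rightarrow> 'a vfield"
    and \<phi> :: "'a \<Rightarrow> 'a tvec \<Rightarrow> 'a tvec"
    and \<xi> :: "'a vfield"
    and \<eta> :: "'a \<Rightarrow> 'a tvec \<Rightarrow> real"
    and g :: "'a \<Rightarrow> 'a tvec \<Rightarrow> 'a tvec \<Rightarrow> real"
  assumes "connected_smooth_manifold \<A>"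
    and "CARD('m) = 2 * n + 1"
    and "levi_civita_connection \<A> g D"
    and "nearly_sasakian \<A> D \<phi> \<xi> \<eta> g"
  shows "contact_form \<A> n \<eta>"
proof -
  interpret nearly_sasakian_manifold \<A> D \<phi> \<xi> \<eta> g
    by unfold_locales (use assms in \<open>simp_all add: connected_smooth_manifold_def\<close>)
  have "form_nonzero_at \<A> (2 * n + 1)
      (wedge 1 (2 * n) (form_of_one_form \<eta>) (wedge_power2 (ext_deriv \<eta>) n)) p" for p
  proof -
    obtain V :: "real ^ 'm \<Rightarrow> 'a vfield" where V: "\<And>v. V v \<in> VF"
      "\<And>a v b w. V (a *\<^sub>R v + b *\<^sub>R w) = (\<lambda>q f. a * V v q f + b * V w q f)"
      "\<And>u. u \<in> T p \<Longrightarrow> \<exists>v. u = V v p" "\<And>v. V v p = (\<lambda>f. 0) \<Longrightarrow> v = 0"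
      using ex_vector_fields_spanning[where p = p] by blast
    \<comment> \<open>The factor 2 is that of \<open>ext_deriv_eta\<close>, so \<open>B v w\<close>
      is the value of d\<eta> at \<open>p\<close> on the fields \<open>V v\<close> and
      \<open>V w\<close>.\<close>
    define B where "B v w = 2 * g p (D (V v) \<xi> p) (V w p)" for v w
    define E where "E v = \<eta> p (V v p)" for v
    have T_V: "V v p \<in> T p" "D (V v) \<xi> p \<in> T p" for v
      using V(1) by (simp_all add: T_intros)
    have alt: "B v w = - B w v" for v w
      using xi_Killing[OF V(1)[of v] V(1)[of w], of p] by (simp add: B_def)
    have comb: "B u (a *\<^sub>R v + b *\<^sub>R w) = a * B u v + b * B u w"
      "E (a *\<^sub>R v + b *\<^sub>R w) = a * E v + b * E w" for u a v b w
      by (simp_all add: B_def E_def V(2) g_add_right g_scale_right T_intros T_V eta_comb algebra_simps)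
    have E: "linear E"
      using comb(2)[of 1 _ 1] comb(2)[of _ _ 0] by (intro linearI) simp_all
    have B1: "linear (B u)" for u
      using comb(1)[of u 1 _ 1] comb(1)[of u _ _ 0] by (intro linearI) simp_all
    have "(\<lambda>v. B v w) = (\<lambda>v. - B w v)" for w
      using alt by blast
    \<comment> \<open>Linearity in the second slot is pointwise linearity of g; alternation carries
      it to the first slot.\<close>
    then have B: "bilinear B"
      using B1 linear_compose_neg[OF B1] by (simp add: bilinear_def)
    obtain e where e: "\<xi> p = V e p" using V(3)[OF T_xi] by blast
    have E_e: "E e = 1" by (simp add: E_def e[symmetric] eta_xi)
    \<comment> \<open>Derivatives of the unit field \<xi> are orthogonal to \<xi>; thus
      \<open>e\<close> is in the radical.\<close>
    have "B w e = 0" for w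
      using eta_D_xi[OF V(1)[of w], of p] eta_eq[OF T_V(2)[of w]] by (simp add: B_def e[symmetric])
    then have B_e: "B e w = 0" for w using alt[of e w] by simp
    have nondeg: "\<exists>w. B v w \<noteq> 0" if "v \<noteq> 0" "E v = 0" for v
    proof -
      obtain w where w: "\<phi> p (V v p) = V w p" using V(3)[OF T_phi[OF T_V(1)]] by blast
      have "V v p \<noteq> (\<lambda>f. 0)" using V(4) that(1) by blast
      then have "g p (V v p) (V v p) > 0"
        using metric T_V(1) by (simp add: riemannian_metric_def)
      \<comment> \<open>Here \<open>w\<close> represents \<phi> of the vector at \<open>p\<close>;
        on the kernel of \<open>E\<close> the value is negative.\<close>
      moreover have "B v w = - 2 * (g p (V v p) (V v p) - (E v)\<^sup>2)"
        using ext_deriv_eta_phi[OF V(1)[of v], of p] by (simp add: B_def E_def w)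
      ultimately have "B v w \<noteq> 0" using that(2) by simp
      then show ?thesis by blast
    qed
    have "DIM(real ^ 'm) = 2 * n + 1" using assms(2) by simp
    from ex_symplectic_frame[OF this B alt E E_e B_e nondeg]
    obtain b where b: "\<forall>i\<le>2 * n. E (b i) = (if i = 0 then 1 else 0) \<and> (\<forall>j\<le>2 * n. B (b i) (b j) = std_symplectic i j)" ..
    have "wedge 1 (2 * n) (form_of_one_form \<eta>) (wedge_power2 (ext_deriv \<eta>) n) (\<lambda>i. V (b i)) p > 0"
    proof (rule wedge_symplectic_frame_pos)
      show "\<eta> p (V (b i) p) = (if i = 0 then 1 else 0)" if "i \<le> 2 * n" for i
        using b that by (simp add: E_def)
      show "ext_deriv \<eta> X p = ext_deriv \<eta> Y p" if "\<And>i. i < 2 \<Longrightarrow> X i = Y i" for X Y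
        using that[of 0] that[of 1] by (simp add: ext_deriv_def)
      show "ext_deriv \<eta> Y p = std_symplectic i j"
        if "i \<le> 2 * n" "j \<le> 2 * n" "Y 0 = V (b i)" "Y 1 = V (b j)" for Y i j
        using ext_deriv_eta[of Y p] b that V(1) by (simp add: B_def)
    qed
    then show ?thesis
      using V(1) unfolding form_nonzero_at_def
      by (intro exI[of _ "\<lambda>i. V (b i)"]) auto
  qed
  then show ?thesis
    using one_form by (simp add: contact_form_def)
qed

end
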